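(* Let $G$ be a $6$-dimensional almost-abelian Lie group with a left-invariant balanced Hermitian structure $(\omega,J)$, such that $(G,J)$ admits a left-invariant nowhere vanishing holomorphic $(3,0)$-form. Let $\tau\in\mathbb{R}$ and let $\nabla^\tau$ be the corresponding Gauduchon connection of $(G,\omega,J)$. If $\nabla^\tau$ is an instanton with respect to $\omega$, then $\nabla^\tau$ is flat. Moreover, for any $\tau\neq1$, $\nabla^\tau$ is an instanton if and only if the metric $\omega$ is Kähler.
   Context: A Lie group is almost-abelian if its Lie algebra has a codimension-one abelian ideal. A Hermitian metric is identified with its fundamental $(1,1)$-form $\omega$; it is balanced if $d(\omega^2)=0$ (complex dimension 3), Kähler if $d\omega=0$. Gauduchon connections: $\nabla^\tau=\frac{1+\tau}{2}\nabla^{Ch}+\frac{1-\tau}{2}\nabla^{B}$, where $\nabla^{Ch}$ is the Chern connection of $(\omega,J)$ and $\nabla^{B}$ the Bismut connection (the unique Hermitian connection with totally skew-symmetric torsion). A connection $\nabla$ is an instanton with respect to $\omega$ if its curvature $\Omega^\nabla$ satisfies the Hermitian-Yang-Mills equation $\omega^2\wedge\Omega^\nabla=0$, $(\Omega^\nabla)^{2,0}=(\Omega^\nabla)^{0,2}=0$ (types taken in the 2-form part of the curvature). *)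

theory Defs
  imports "HOL-Analysis.Analysis" "HOL-Combinatorics.Permutations"
begin

section \<open>Smooth maps between open subsets of normed spaces\<close>

text \<open>
  The set \<open>S\<close> is always meant to be open.  For functions on a finite-dimensional space,
  \<open>Ck_on k S f\<close> says that \<open>f\<close> is of class \<open>C\<^sup>k\<close> on \<open>S\<close>.
\<close>

primrec Ck_on :: "nat \<Rightarrow> 'a::real_normed_vector set \<Rightarrow> ('a \<Rightarrow> 'b::real_normed_vector) \<Rightarrow> bool" where
  "Ck_on 0 S f \<longleftrightarrow> continuous_on S f"
| "Ck_on (Suc k) S f \<longleftrightarrow>
     (\<forall>x\<in>S. f differentiable (at x)) \<and> (\<forall>v. Ck_on k S (\<lambda>x. frechet_derivative f (at x) v))"

definition smooth_on :: "'a::real_normed_vector set \<Rightarrow> ('a \<Rightarrow> 'b::real_normed_vector) \<Rightarrow> bool" where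
  "smooth_on S f \<longleftrightarrow> (\<forall>k. Ck_on k S f)"

lemma Ck_on_cong:
  assumes "open S" "\<And>x. x \<in> S \<Longrightarrow> f x = g x"
  shows "Ck_on k S f \<longleftrightarrow> Ck_on k S g"
  using assms(2)
proof (induction k arbitrary: f g)
  case 0
  then show ?case by (auto cong: continuous_on_cong)
next
  case (Suc k)
  have d: "f differentiable (at x) \<longleftrightarrow> g differentiable (at x)" if "x \<in> S" for x
    using Suc.prems that assms(1)
    by (metis (no_types, lifting) differentiable_def has_derivative_transform_within_open)
  show ?case
  proof (cases "\<forall>x\<in>S. f differentiable (at x)")
    case True
    have "frechet_derivative f (at x) = frechet_derivative g (at x)" if "x \<in> S" for x
      using frechet_derivative_transform_within_open[of f x S g] True that assms(1) Suc.prems by auto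
    then have "Ck_on k S (\<lambda>x. frechet_derivative f (at x) v) \<longleftrightarrow>
               Ck_on k S (\<lambda>x. frechet_derivative g (at x) v)" for v
      by (intro Suc.IH) auto
    then show ?thesis using d by auto
  next
    case False
    then show ?thesis using d by auto
  qed
qed

lemma Ck_on_subset: "Ck_on k S f \<Longrightarrow> T \<subseteq> S \<Longrightarrow> Ck_on k T f"
  by (induction k arbitrary: f) (auto intro: continuous_on_subset)

lemma Ck_on_local:
  assumes "\<And>x. x \<in> S \<Longrightarrow> \<exists>T. open T \<and> x \<in> T \<and> Ck_on k T f"
  shows "Ck_on k S f"
  using assms
proof (induction k arbitrary: f)
  case 0
  have "\<exists>T. open T \<and> x \<in> T \<and> continuous_on T f" if "x \<in> S" for x
    using 0[OF that] by auto
  then have "isCont f x" if "x \<in> S" for x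
    using that continuous_on_eq_continuous_at by blast
  then show ?case
    by (simp add: continuous_at_imp_continuous_on)
next
  case (Suc k)
  have "f differentiable (at x)" if "x \<in> S" for x
    using Suc.prems[OF that] by auto
  moreover have "Ck_on k S (\<lambda>x. frechet_derivative f (at x) v)" for v
  proof (rule Suc.IH)
    fix x assume "x \<in> S"
    then obtain T where "open T" "x \<in> T" "Ck_on (Suc k) T f"
      using Suc.prems by blast
    then show "\<exists>T. open T \<and> x \<in> T \<and> Ck_on k T (\<lambda>x. frechet_derivative f (at x) v)"
      by (intro exI[of _ T]) simp
  qed
  ultimately show ?case by auto
qed

lemma Ck_on_SucD: "Ck_on (Suc k) S f \<Longrightarrow> Ck_on k S f"
proof (induction k arbitrary: f)
  case 0
  then show ?case
    by (auto intro!: continuous_at_imp_continuous_on differentiable_imp_continuous_within)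
next
  case (Suc k)
  then show ?case by auto
qed

lemma Ck_on_const [simp]: "Ck_on k S (\<lambda>x. c)"
  by (induction k arbitrary: c) auto

lemma Ck_on_SucI:
  assumes "open S" "\<And>x. x \<in> S \<Longrightarrow> (f has_derivative f' x) (at x)" "\<And>v. Ck_on k S (\<lambda>x. f' x v)"
  shows "Ck_on (Suc k) S f"
proof -
  have "frechet_derivative f (at x) = f' x" if "x \<in> S" for x
    using assms(2)[OF that] frechet_derivative_at by metis
  then have "Ck_on k S (\<lambda>x. frechet_derivative f (at x) v)" for v
    using assms(3)[of v] Ck_on_cong[OF assms(1), of "\<lambda>x. frechet_derivative f (at x) v" "\<lambda>x. f' x v"]
    by auto
  then show ?thesis
    using assms(2) by (auto simp: differentiable_def)
qed

lemma Ck_on_SucE: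
  assumes "Ck_on (Suc k) S f"
  obtains f' where "\<And>x. x \<in> S \<Longrightarrow> (f has_derivative f' x) (at x)" "\<And>v. Ck_on k S (\<lambda>x. f' x v)"
  using assms that[of "\<lambda>x. frechet_derivative f (at x)"] by (auto simp: frechet_derivative_works)

lemma Ck_on_bounded_linear:
  assumes "open S" "bounded_linear h"
  shows "Ck_on k S h"
proof (cases k)
  case 0
  then show ?thesis using assms by (simp add: linear_continuous_on)
next
  case (Suc n)
  show ?thesis unfolding Suc
    by (rule Ck_on_SucI[OF assms(1), where f' = "\<lambda>x. h"])
       (use assms in \<open>auto intro: bounded_linear_imp_has_derivative\<close>)
qed

lemma Ck_on_add:
  assumes "open S" "Ck_on k S f" "Ck_on k S g"
  shows "Ck_on k S (\<lambda>x. f x + g x)"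
  using assms(2,3)
proof (induction k arbitrary: f g)
  case 0
  then show ?case by (auto intro: continuous_on_add)
next
  case (Suc k)
  obtain f' where f': "\<And>x. x \<in> S \<Longrightarrow> (f has_derivative f' x) (at x)" "\<And>v. Ck_on k S (\<lambda>x. f' x v)"
    using Ck_on_SucE[OF Suc.prems(1)] by blast
  obtain g' where g': "\<And>x. x \<in> S \<Longrightarrow> (g has_derivative g' x) (at x)" "\<And>v. Ck_on k S (\<lambda>x. g' x v)"
    using Ck_on_SucE[OF Suc.prems(2)] by blast
  show ?case
    by (rule Ck_on_SucI[OF assms(1), where f' = "\<lambda>x v. f' x v + g' x v"])
       (auto intro!: has_derivative_add f' g' Suc.IH)
qed

lemma Ck_on_prod:
  assumes "open S" "bounded_bilinear h" "Ck_on k S f" "Ck_on k S g"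
  shows "Ck_on k S (\<lambda>x. h (f x) (g x))"
  using assms(3,4)
proof (induction k arbitrary: f g)
  case 0
  then show ?case using bounded_bilinear.continuous_on[OF assms(2)] by auto
next
  case (Suc k)
  obtain f' where f': "\<And>x. x \<in> S \<Longrightarrow> (f has_derivative f' x) (at x)" "\<And>v. Ck_on k S (\<lambda>x. f' x v)"
    using Ck_on_SucE[OF Suc.prems(1)] by blast
  obtain g' where g': "\<And>x. x \<in> S \<Longrightarrow> (g has_derivative g' x) (at x)" "\<And>v. Ck_on k S (\<lambda>x. g' x v)"
    using Ck_on_SucE[OF Suc.prems(2)] by blast
  have fg: "Ck_on k S f" "Ck_on k S g"
    using Suc.prems Ck_on_SucD by blast+
  show ?case
  proof (rule Ck_on_SucI[OF assms(1), where f' = "\<lambda>x v. h (f x) (g' x v) + h (f' x v) (g x)"])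
    show "((\<lambda>x. h (f x) (g x)) has_derivative (\<lambda>v. h (f x) (g' x v) + h (f' x v) (g x))) (at x)"
      if "x \<in> S" for x
      using bounded_bilinear.FDERIV[OF assms(2) f'(1)[OF that] g'(1)[OF that]] .
    show "Ck_on k S (\<lambda>x. h (f x) (g' x v) + h (f' x v) (g x))" for v
      by (intro Ck_on_add Suc.IH assms(1) fg f'(2) g'(2))
  qed
qed

lemma Ck_on_sum:
  assumes "open S" "\<And>i. i \<in> I \<Longrightarrow> Ck_on k S (f i)"
  shows "Ck_on k S (\<lambda>x. \<Sum>i\<in>I. f i x)"
  using assms(2) by (induction I rule: infinite_finite_induct) (auto intro: Ck_on_add[OF assms(1)])

lemma Ck_on_compose:
  fixes f :: "'a::real_normed_vector \<Rightarrow> 'b::euclidean_space" and g :: "'b \<Rightarrow> 'c::real_normed_vector"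
  assumes "open S" "Ck_on k S f" "Ck_on k T g" "f ` S \<subseteq> T"
  shows "Ck_on k S (\<lambda>x. g (f x))"
  using assms(2,3)
proof (induction k arbitrary: g)
  case 0
  then show ?case
    using continuous_on_compose2[of T g S f] assms(4) by auto
next
  case (Suc k)
  obtain f' where f': "\<And>x. x \<in> S \<Longrightarrow> (f has_derivative f' x) (at x)" "\<And>v. Ck_on k S (\<lambda>x. f' x v)"
    using Ck_on_SucE[OF Suc.prems(1)] by blast
  obtain g' where g': "\<And>x. x \<in> T \<Longrightarrow> (g has_derivative g' x) (at x)" "\<And>v. Ck_on k T (\<lambda>x. g' x v)"
    using Ck_on_SucE[OF Suc.prems(2)] by blast
  have fk: "Ck_on k S f" using Suc.prems(1) Ck_on_SucD by blast
  show ?case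
  proof (rule Ck_on_SucI[OF assms(1), where f' = "\<lambda>x v. \<Sum>b\<in>Basis. (f' x v \<bullet> b) *\<^sub>R g' (f x) b"])
    fix x assume x: "x \<in> S"
    then have fx: "f x \<in> T" using assms(4) by auto
    have lin: "linear (g' (f x))"
      using g'(1)[OF fx] has_derivative_linear by blast
    have eq: "g' (f x) (f' x v) = (\<Sum>b\<in>Basis. (f' x v \<bullet> b) *\<^sub>R g' (f x) b)" for v
    proof -
      have "g' (f x) (f' x v) = g' (f x) (\<Sum>b\<in>Basis. (f' x v \<bullet> b) *\<^sub>R b)"
        by (simp only: euclidean_representation)
      also have "\<dots> = (\<Sum>b\<in>Basis. (f' x v \<bullet> b) *\<^sub>R g' (f x) b)"
        by (simp only: linear_sum[OF lin] linear_cmul[OF lin])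
      finally show ?thesis .
    qed
    have "((\<lambda>x. g (f x)) has_derivative (\<lambda>v. g' (f x) (f' x v))) (at x)"
      using has_derivative_compose[OF f'(1)[OF x] g'(1)[OF fx]] .
    then show "((\<lambda>x. g (f x)) has_derivative (\<lambda>v. \<Sum>b\<in>Basis. (f' x v \<bullet> b) *\<^sub>R g' (f x) b)) (at x)"
      by (simp only: eq)
  next
    fix v
    show "Ck_on k S (\<lambda>x. \<Sum>b\<in>Basis. (f' x v \<bullet> b) *\<^sub>R g' (f x) b)"
      by (intro Ck_on_sum Ck_on_prod[OF assms(1) bounded_bilinear_scaleR]
            Ck_on_prod[OF assms(1) bounded_bilinear_inner] assms(1) f'(2) Ck_on_const
            Suc.IH[OF fk] g'(2))
  qed
qed

lemma Ck_on_Pair_left: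
  fixes c :: "'a::real_normed_vector"
  assumes "open S"
  shows "Ck_on k S (\<lambda>x::'b::real_normed_vector. (c, x))"
proof (cases k)
  case 0
  then show ?thesis by (auto intro: continuous_intros)
next
  case (Suc n)
  show ?thesis unfolding Suc
    by (rule Ck_on_SucI[OF assms, where f' = "\<lambda>x v. (0, v)"])
       (auto intro!: derivative_eq_intros)
qed

section \<open>Six-dimensional Lie groups\<close>

text \<open>
  A chart is a pair \<open>(U, \<phi>)\<close> in which only the values of \<open>\<phi>\<close> on \<open>U\<close> matter; \<open>atlas_homeo\<close> says
  that \<open>\<phi>\<close> is a homeomorphism of \<open>U\<close> onto an open subset of the model space.
  The group operation is written additively because \<open>group_add\<close> is the library's class of
  not necessarily commutative groups; its topological version makes the operations continuous.
\<close>

class lie_group6 = topological_group_add + t2_space + second_countable_topology +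
  fixes atlas :: "('a set \<times> ('a \<Rightarrow> real ^ 6)) set"
  assumes atlas_cover: "\<exists>U \<phi>. (U, \<phi>) \<in> atlas \<and> x \<in> U"
    and atlas_open: "(U, \<phi>) \<in> atlas \<Longrightarrow> open U"
    and atlas_inj: "(U, \<phi>) \<in> atlas \<Longrightarrow> inj_on \<phi> U"
    and atlas_homeo: "(U, \<phi>) \<in> atlas \<Longrightarrow> S \<subseteq> U \<Longrightarrow> open S \<longleftrightarrow> open (\<phi> ` S)"
    and atlas_smooth: "(U, \<phi>) \<in> atlas \<Longrightarrow> (V, \<psi>) \<in> atlas \<Longrightarrow>
      smooth_on (\<phi> ` (U \<inter> V)) (\<lambda>u. \<psi> (inv_into U \<phi> u))"
    and smooth_plus: "(U, \<phi>) \<in> atlas \<Longrightarrow> (V, \<psi>) \<in> atlas \<Longrightarrow> (W, \<theta>) \<in> atlas \<Longrightarrow>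
      smooth_on {(\<phi> x, \<psi> y) | x y. x \<in> U \<and> y \<in> V \<and> x + y \<in> W}
        (\<lambda>(u, v). \<theta> (inv_into U \<phi> u + inv_into V \<psi> v))"
    and smooth_uminus: "(U, \<phi>) \<in> atlas \<Longrightarrow> (V, \<psi>) \<in> atlas \<Longrightarrow>
      smooth_on {\<phi> x | x. x \<in> U \<and> - x \<in> V} (\<lambda>u. \<psi> (- inv_into U \<phi> u))"

definition smooth_fun_on :: "'g::lie_group6 set \<Rightarrow> ('g \<Rightarrow> real) \<Rightarrow> bool" where
  "smooth_fun_on W f \<longleftrightarrow> (\<forall>(U, \<phi>)\<in>atlas. smooth_on (\<phi> ` (U \<inter> W)) (\<lambda>u. f (inv_into U \<phi> u)))"

definition smooth_at :: "'g::lie_group6 \<Rightarrow> ('g \<Rightarrow> real) \<Rightarrow> bool" where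
  "smooth_at p f \<longleftrightarrow> (\<exists>W. open W \<and> p \<in> W \<and> smooth_fun_on W f)"

lemma open_chart_image:
  assumes "(U, \<phi>) \<in> (atlas :: ('g::lie_group6 set \<times> _) set)" "open W"
  shows "open (\<phi> ` (U \<inter> W))"
  using atlas_homeo[OF assms(1), of "U \<inter> W"] atlas_open[OF assms(1)] assms(2) by blast

lemma smooth_fun_on_subset:
  assumes "smooth_fun_on W f" "W' \<subseteq> W"
  shows "smooth_fun_on W' f"
  unfolding smooth_fun_on_def smooth_on_def
proof (safe)
  fix U :: "'a set" and \<phi> k assume "(U, \<phi>) \<in> atlas"
  then have "Ck_on k (\<phi> ` (U \<inter> W)) (\<lambda>u. f (inv_into U \<phi> u))"
    using assms(1) unfolding smooth_fun_on_def smooth_on_def by blast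
  then show "Ck_on k (\<phi> ` (U \<inter> W')) (\<lambda>u. f (inv_into U \<phi> u))"
    by (rule Ck_on_subset) (use assms(2) in blast)
qed

lemma smooth_fun_on_congI:
  assumes "open W" "\<And>x. x \<in> W \<Longrightarrow> f x = g x" "smooth_fun_on W f"
  shows "smooth_fun_on W g"
  unfolding smooth_fun_on_def smooth_on_def
proof (safe)
  fix U :: "'a set" and \<phi> k assume U: "(U, \<phi>) \<in> atlas"
  have "Ck_on k (\<phi> ` (U \<inter> W)) (\<lambda>u. f (inv_into U \<phi> u))"
    using assms(3) U unfolding smooth_fun_on_def smooth_on_def by blast
  then show "Ck_on k (\<phi> ` (U \<inter> W)) (\<lambda>u. g (inv_into U \<phi> u))"
    by (rule iffD1[OF Ck_on_cong[OF open_chart_image[OF U assms(1)]], rotated])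
       (use assms(2) atlas_inj[OF U] in auto)
qed

lemma smooth_fun_on_const: "smooth_fun_on W (\<lambda>_. c)"
  unfolding smooth_fun_on_def smooth_on_def by auto

lemma smooth_fun_on_add:
  assumes "open W" "smooth_fun_on W f" "smooth_fun_on W g"
  shows "smooth_fun_on W (\<lambda>x. f x + g x)"
  unfolding smooth_fun_on_def smooth_on_def
proof (safe)
  fix U :: "'a set" and \<phi> k assume U: "(U, \<phi>) \<in> atlas"
  show "Ck_on k (\<phi> ` (U \<inter> W)) (\<lambda>u. f (inv_into U \<phi> u) + g (inv_into U \<phi> u))"
    by (rule Ck_on_add[OF open_chart_image[OF U assms(1)]])
       (use assms(2,3) U in \<open>unfold smooth_fun_on_def smooth_on_def, blast+\<close>)
qed

lemma smooth_fun_on_mult: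
  assumes "open W" "smooth_fun_on W f" "smooth_fun_on W g"
  shows "smooth_fun_on W (\<lambda>x. f x * g x)"
  unfolding smooth_fun_on_def smooth_on_def
proof (safe)
  fix U :: "'a set" and \<phi> k assume U: "(U, \<phi>) \<in> atlas"
  show "Ck_on k (\<phi> ` (U \<inter> W)) (\<lambda>u. f (inv_into U \<phi> u) * g (inv_into U \<phi> u))"
    by (rule Ck_on_prod[OF open_chart_image[OF U assms(1)] bounded_bilinear_mult])
       (use assms(2,3) U in \<open>unfold smooth_fun_on_def smooth_on_def, blast+\<close>)
qed

lemma smooth_fun_on_scale:
  "open W \<Longrightarrow> smooth_fun_on W f \<Longrightarrow> smooth_fun_on W (\<lambda>x. c * f x)"
  using smooth_fun_on_mult[OF _ smooth_fun_on_const] by blast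

lemma smooth_at_common:
  assumes "smooth_at p f" "smooth_at p g"
  obtains W where "open W" "p \<in> W" "smooth_fun_on W f" "smooth_fun_on W g"
proof -
  obtain W1 W2 where "open W1" "p \<in> W1" "smooth_fun_on W1 f" "open W2" "p \<in> W2" "smooth_fun_on W2 g"
    using assms unfolding smooth_at_def by auto
  then show ?thesis
    by (intro that[of "W1 \<inter> W2"]) (auto intro: smooth_fun_on_subset)
qed

lemma smooth_at_const: "smooth_at p (\<lambda>_. c)"
  unfolding smooth_at_def using smooth_fun_on_const by blast

lemma smooth_at_add: "smooth_at p f \<Longrightarrow> smooth_at p g \<Longrightarrow> smooth_at p (\<lambda>x. f x + g x)"
  by (erule (1) smooth_at_common) (auto simp: smooth_at_def intro!: smooth_fun_on_add)

lemma smooth_at_mult: "smooth_at p f \<Longrightarrow> smooth_at p g \<Longrightarrow> smooth_at p (\<lambda>x. f x * g x)"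
  by (erule (1) smooth_at_common) (auto simp: smooth_at_def intro!: smooth_fun_on_mult)

lemma open_translate:
  fixes a :: "'g::lie_group6"
  assumes "open W"
  shows "open {x. a + x \<in> W}"
proof -
  have "continuous_on UNIV (\<lambda>x. a + x)"
    by (intro continuous_intros)
  from continuous_on_open_vimage[THEN iffD1, OF _ this] assms
  have "open ((\<lambda>x. a + x) -` W \<inter> UNIV)" by blast
  then show ?thesis by (simp add: vimage_def)
qed

lemma smooth_fun_on_translate:
  fixes a :: "'g::lie_group6"
  assumes "open W" "smooth_fun_on W f"
  shows "smooth_fun_on {x. a + x \<in> W} (\<lambda>x. f (a + x))"
  unfolding smooth_fun_on_def smooth_on_def
proof (safe)
  fix V :: "'g set" and \<psi> k assume V: "(V, \<psi>) \<in> atlas"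
  note inj = atlas_inj[OF V]
  show "Ck_on k (\<psi> ` (V \<inter> {x. a + x \<in> W})) (\<lambda>u. f (a + inv_into V \<psi> u))"
  proof (rule Ck_on_local)
    fix u assume "u \<in> \<psi> ` (V \<inter> {x. a + x \<in> W})"
    then obtain x where x: "x \<in> V" "a + x \<in> W" "u = \<psi> x" by auto
    obtain U \<phi> where U: "(U, \<phi>) \<in> atlas" "a \<in> U" using atlas_cover by blast
    obtain Z \<theta> where Z: "(Z, \<theta>) \<in> atlas" "a + x \<in> Z" using atlas_cover by blast
    have oZ: "open (Z \<inter> W)" using atlas_open[OF Z(1)] assms(1) by blast
    define T where "T = \<psi> ` (V \<inter> {y. a + y \<in> Z \<inter> W})"
    have oT: "open T"
      unfolding T_def by (rule open_chart_image[OF V open_translate[OF oZ]])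
    have uT: "u \<in> T" unfolding T_def using x Z by auto
    define m where "m = (\<lambda>v. \<theta> (a + inv_into V \<psi> v))"
    have "Ck_on k {(\<phi> x, \<psi> y) | x y. x \<in> U \<and> y \<in> V \<and> x + y \<in> Z}
        (\<lambda>(u, v). \<theta> (inv_into U \<phi> u + inv_into V \<psi> v))"
      using smooth_plus[OF U(1) V Z(1)] unfolding smooth_on_def by blast
    then have "Ck_on k T (\<lambda>v. (\<lambda>(u, v). \<theta> (inv_into U \<phi> u + inv_into V \<psi> v)) (\<phi> a, v))"
    proof (rule Ck_on_compose[OF oT Ck_on_Pair_left[OF oT]])
      show "Pair (\<phi> a) ` T \<subseteq> {(\<phi> x, \<psi> y) |x y. x \<in> U \<and> y \<in> V \<and> x + y \<in> Z}"
        unfolding T_def using U(2) by blast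
    qed
    then have m: "Ck_on k T m"
      unfolding m_def using atlas_inj[OF U(1)] U(2) by simp
    have "Ck_on k (\<theta> ` (Z \<inter> W)) (\<lambda>u. f (inv_into Z \<theta> u))"
      using assms(2) Z(1) unfolding smooth_fun_on_def smooth_on_def by blast
    then have "Ck_on k T (\<lambda>v. f (inv_into Z \<theta> (m v)))"
    proof (rule Ck_on_compose[OF oT m])
      show "m ` T \<subseteq> \<theta> ` (Z \<inter> W)"
        unfolding T_def m_def using inj by auto
    qed
    moreover have "f (inv_into Z \<theta> (m v)) = f (a + inv_into V \<psi> v)" if "v \<in> T" for v
      using that unfolding T_def m_def using inj atlas_inj[OF Z(1)] by auto
    ultimately have "Ck_on k T (\<lambda>v. f (a + inv_into V \<psi> v))"
      by (rule iffD1[OF Ck_on_cong[OF oT], rotated])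
    then show "\<exists>T. open T \<and> u \<in> T \<and> Ck_on k T (\<lambda>u. f (a + inv_into V \<psi> u))"
      using oT uT by blast
  qed
qed

lemma smooth_at_translate:
  fixes a :: "'g::lie_group6"
  shows "smooth_at (a + p) f \<longleftrightarrow> smooth_at p (\<lambda>x. f (a + x))"
proof -
  have *: "smooth_at q (\<lambda>x. h (b + x))" if bq: "smooth_at (b + q) h" for b q and h :: "'g \<Rightarrow> real"
  proof -
    obtain W where W: "open W" "b + q \<in> W" "smooth_fun_on W h"
      using bq unfolding smooth_at_def by blast
    show ?thesis
      unfolding smooth_at_def
      by (rule exI[of _ "{x. b + x \<in> W}"])
         (use W open_translate[OF W(1)] smooth_fun_on_translate[OF W(1,3)] in simp)
  qed
  show ?thesis
  proof
    show "smooth_at p (\<lambda>x. f (a + x))" if "smooth_at (a + p) f"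
      using *[OF that] .
    assume "smooth_at p (\<lambda>x. f (a + x))"
    then have "smooth_at (- a + (a + p)) (\<lambda>x. f (a + x))"
      by (simp add: add.assoc[symmetric])
    from *[OF this] show "smooth_at (a + p) f"
      by (simp add: add.assoc[symmetric])
  qed
qed

section \<open>The Lie algebra of left-invariant vector fields\<close>

text \<open>
  A vector field is encoded by its action on real functions.  At each point \<open>p\<close> it is a derivation
  of the algebra of functions that are smooth near \<open>p\<close>; such a derivation automatically depends on
  the germ at \<open>p\<close> only.  Functions that are not smooth near \<open>p\<close> are sent to \<open>0\<close>,
  so that distinct operators are distinct vector fields.
\<close>

definition tangent_vector :: "'g::lie_group6 \<Rightarrow> (('g \<Rightarrow> real) \<Rightarrow> real) \<Rightarrow> bool" where
  "tangent_vector p D \<longleftrightarrow>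
     (\<forall>f g. smooth_at p f \<longrightarrow> smooth_at p g \<longrightarrow> D (\<lambda>x. f x + g x) = D f + D g) \<and>
     (\<forall>c f. smooth_at p f \<longrightarrow> D (\<lambda>x. c * f x) = c * D f) \<and>
     (\<forall>f g. smooth_at p f \<longrightarrow> smooth_at p g \<longrightarrow> D (\<lambda>x. f x * g x) = f p * D g + g p * D f) \<and>
     (\<forall>f. \<not> smooth_at p f \<longrightarrow> D f = 0)"

definition smooth_vector_field :: "(('g::lie_group6 \<Rightarrow> real) \<Rightarrow> 'g \<Rightarrow> real) \<Rightarrow> bool" where
  "smooth_vector_field X \<longleftrightarrow>
     (\<forall>p. tangent_vector p (\<lambda>f. X f p)) \<and>
     (\<forall>W f. open W \<longrightarrow> smooth_fun_on W f \<longrightarrow> smooth_fun_on W (X f))"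

definition left_invariant :: "(('g::lie_group6 \<Rightarrow> real) \<Rightarrow> 'g \<Rightarrow> real) \<Rightarrow> bool" where
  "left_invariant X \<longleftrightarrow> (\<forall>a p f. X f (a + p) = X (\<lambda>x. f (a + x)) p)"

typedef (overloaded) 'g lie_algebra =
  "{X :: ('g::lie_group6 \<Rightarrow> real) \<Rightarrow> 'g \<Rightarrow> real. smooth_vector_field X \<and> left_invariant X}"
  morphisms act Lie_Algebra
proof
  show "(\<lambda>f p. 0) \<in> {X :: ('g \<Rightarrow> real) \<Rightarrow> 'g \<Rightarrow> real. smooth_vector_field X \<and> left_invariant X}"
    by (auto simp: smooth_vector_field_def tangent_vector_def left_invariant_def smooth_fun_on_const)
qed

setup_lifting type_definition_lie_algebra

instantiation lie_algebra :: (lie_group6) real_vector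
begin

lift_definition zero_lie_algebra :: "'a lie_algebra" is "\<lambda>f p. 0"
  by (auto simp: smooth_vector_field_def tangent_vector_def left_invariant_def smooth_fun_on_const)

lift_definition plus_lie_algebra :: "'a lie_algebra \<Rightarrow> 'a lie_algebra \<Rightarrow> 'a lie_algebra"
  is "\<lambda>X Y f p. X f p + Y f p"
  by (auto simp: smooth_vector_field_def tangent_vector_def left_invariant_def smooth_fun_on_add
      algebra_simps)

lift_definition scaleR_lie_algebra :: "real \<Rightarrow> 'a lie_algebra \<Rightarrow> 'a lie_algebra"
  is "\<lambda>c X f p. c * X f p"
  by (auto simp: smooth_vector_field_def tangent_vector_def left_invariant_def smooth_fun_on_scale
      algebra_simps)

definition uminus_lie_algebra :: "'a lie_algebra \<Rightarrow> 'a lie_algebra"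
  where "uminus_lie_algebra X = (-1) *\<^sub>R X"

definition minus_lie_algebra :: "'a lie_algebra \<Rightarrow> 'a lie_algebra \<Rightarrow> 'a lie_algebra"
  where "minus_lie_algebra X Y = X + (-1) *\<^sub>R Y"

instance
  by standard
    ((unfold uminus_lie_algebra_def minus_lie_algebra_def)?; transfer; simp add: algebra_simps fun_eq_iff)+

end

lemma smooth_at_cong:
  assumes "open W" "p \<in> W" "\<And>x. x \<in> W \<Longrightarrow> f x = g x" "smooth_at p f"
  shows "smooth_at p g"
proof -
  obtain V where V: "open V" "p \<in> V" "smooth_fun_on V f"
    using assms(4) unfolding smooth_at_def by blast
  have "smooth_fun_on (V \<inter> W) f"
    using smooth_fun_on_subset[OF V(3)] by blast
  then have "smooth_fun_on (V \<inter> W) g"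
    by (rule smooth_fun_on_congI[rotated 2]) (use V(1) assms(1,3) in auto)
  then show ?thesis
    unfolding smooth_at_def using V assms(1,2) by blast
qed

lemma tangent_vector_local:
  assumes D: "tangent_vector p D" and W: "open W" "p \<in> W" "\<And>x. x \<in> W \<Longrightarrow> f x = g x"
    and f: "smooth_at p f"
  shows "D f = D g"
proof -
  have g: "smooth_at p g" by (rule smooth_at_cong[OF W f])
  define h e where "h = (\<lambda>x. f x + (-1) * g x)" and "e = (\<lambda>x. if x \<in> W then 0 else (1::real))"
  have h: "smooth_at p h"
    unfolding h_def by (intro smooth_at_add smooth_at_mult smooth_at_const f g)
  have e: "smooth_at p e"
    by (rule smooth_at_cong[OF W(1,2) _ smooth_at_const[of p 0]]) (simp add: e_def)
  have "D h = D (\<lambda>x. h x * e x)"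
    by (rule arg_cong[where f = D]) (auto simp: h_def e_def W(3))
  also have "\<dots> = h p * D e + e p * D h"
    using D h e unfolding tangent_vector_def by blast
  also have "\<dots> = 0"
    using W by (simp add: h_def e_def)
  finally have "D h = 0" .
  moreover have "D h = D f + D (\<lambda>x. (-1) * g x)"
    using D f smooth_at_mult[OF smooth_at_const g] unfolding h_def tangent_vector_def by blast
  moreover have "D (\<lambda>x. (-1) * g x) = (-1) * D g"
    using D g unfolding tangent_vector_def by blast
  ultimately show ?thesis by simp
qed

lemma smooth_at_nhd:
  assumes "smooth_at p f" "smooth_at p g"
  obtains W where "open W" "p \<in> W" "\<And>q. q \<in> W \<Longrightarrow> smooth_at q f \<and> smooth_at q g"
  by (rule smooth_at_common[OF assms]) (metis smooth_at_def)

lift_definition lie_bracket :: "'g::lie_group6 lie_algebra \<Rightarrow> 'g lie_algebra \<Rightarrow> 'g lie_algebra"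
  is "\<lambda>X Y f p. if smooth_at p f then X (Y f) p - Y (X f) p else 0"
proof -
  fix X Y :: "('g \<Rightarrow> real) \<Rightarrow> 'g \<Rightarrow> real"
  assume X: "smooth_vector_field X \<and> left_invariant X"
    and Y: "smooth_vector_field Y \<and> left_invariant Y"
  define B where "B = (\<lambda>f p. if smooth_at p f then X (Y f) p - Y (X f) p else 0)"
  define VF where "VF = {Z :: ('g \<Rightarrow> real) \<Rightarrow> 'g \<Rightarrow> real. smooth_vector_field Z \<and> left_invariant Z}"
  have XY: "X \<in> VF" "Y \<in> VF" using X Y by (auto simp: VF_def)
  have tv: "tangent_vector p (\<lambda>f. Z f p)" if "Z \<in> VF" for Z p
    using that unfolding VF_def smooth_vector_field_def by blast
  have sm: "smooth_at p (Z f)" if "Z \<in> VF" "smooth_at p f" for Z p and f :: "'g \<Rightarrow> real"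
    using that unfolding VF_def smooth_vector_field_def smooth_at_def by blast
  have add: "Z (\<lambda>x. f x + g x) p = Z f p + Z g p"
    if "Z \<in> VF" "smooth_at p f" "smooth_at p g" for Z p f g
    using tv[OF that(1), of p] that(2,3) unfolding tangent_vector_def by blast
  have scale: "Z (\<lambda>x. c * f x) p = c * Z f p" if "Z \<in> VF" "smooth_at p f" for Z p c f
    using tv[OF that(1), of p] that(2) unfolding tangent_vector_def by blast
  have mult: "Z (\<lambda>x. f x * g x) p = f p * Z g p + g p * Z f p"
    if "Z \<in> VF" "smooth_at p f" "smooth_at p g" for Z p f g
    using tv[OF that(1), of p] that(2,3) unfolding tangent_vector_def by blast
  have loc: "Z f p = Z g p"
    if "Z \<in> VF" "smooth_at p f" "open W" "p \<in> W" "\<And>x. x \<in> W \<Longrightarrow> f x = g x" for Z W p f g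
    using tangent_vector_local[OF tv[OF that(1)] that(3,4,5,2)] .
  have add2: "Z (Z' (\<lambda>x. f x + g x)) p = Z (Z' f) p + Z (Z' g) p"
    if Z: "Z \<in> VF" "Z' \<in> VF" and f: "smooth_at p f" and g: "smooth_at p g" for Z Z' p f g
  proof -
    obtain W where W: "open W" "p \<in> W" "\<And>q. q \<in> W \<Longrightarrow> smooth_at q f \<and> smooth_at q g"
      using smooth_at_nhd[OF f g] by blast
    have "Z (Z' (\<lambda>x. f x + g x)) p = Z (\<lambda>x. Z' f x + Z' g x) p"
      by (rule loc[OF Z(1) sm[OF Z(2) smooth_at_add[OF f g]] W(1,2)]) (rule add[OF Z(2)]; use W(3) in blast)
    also have "\<dots> = Z (Z' f) p + Z (Z' g) p"
      by (rule add[OF Z(1) sm[OF Z(2) f] sm[OF Z(2) g]])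
    finally show ?thesis .
  qed
  have scale2: "Z (Z' (\<lambda>x. c * f x)) p = c * Z (Z' f) p"
    if Z: "Z \<in> VF" "Z' \<in> VF" and f: "smooth_at p f" for Z Z' p c f
  proof -
    obtain W where W: "open W" "p \<in> W" "\<And>q. q \<in> W \<Longrightarrow> smooth_at q f \<and> smooth_at q f"
      using smooth_at_nhd[OF f f] by blast
    have "Z (Z' (\<lambda>x. c * f x)) p = Z (\<lambda>x. c * Z' f x) p"
      by (rule loc[OF Z(1) sm[OF Z(2) smooth_at_mult[OF smooth_at_const f]] W(1,2)])
         (rule scale[OF Z(2)]; use W(3) in blast)
    also have "\<dots> = c * Z (Z' f) p"
      by (rule scale[OF Z(1) sm[OF Z(2) f]])
    finally show ?thesis .
  qed
  have mult2: "Z (Z' (\<lambda>x. f x * g x)) p =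
      f p * Z (Z' g) p + Z f p * Z' g p + g p * Z (Z' f) p + Z g p * Z' f p"
    if Z: "Z \<in> VF" "Z' \<in> VF" and f: "smooth_at p f" and g: "smooth_at p g" for Z Z' p f g
  proof -
    obtain W where W: "open W" "p \<in> W" "\<And>q. q \<in> W \<Longrightarrow> smooth_at q f \<and> smooth_at q g"
      using smooth_at_nhd[OF f g] by blast
    note s = sm[OF Z(2) f] sm[OF Z(2) g]
    have "Z (Z' (\<lambda>x. f x * g x)) p = Z (\<lambda>x. f x * Z' g x + g x * Z' f x) p"
      by (rule loc[OF Z(1) sm[OF Z(2) smooth_at_mult[OF f g]] W(1,2)]) (rule mult[OF Z(2)]; use W(3) in blast)
    also have "\<dots> = Z (\<lambda>x. f x * Z' g x) p + Z (\<lambda>x. g x * Z' f x) p"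
      by (rule add[OF Z(1) smooth_at_mult[OF f s(2)] smooth_at_mult[OF g s(1)]])
    also have "\<dots> = f p * Z (Z' g) p + Z' g p * Z f p + (g p * Z (Z' f) p + Z' f p * Z g p)"
      using mult[OF Z(1) f s(2)] mult[OF Z(1) g s(1)] by simp
    finally show ?thesis by (simp add: algebra_simps)
  qed
  have scaleB: "B (\<lambda>x. c * f x) p = c * B f p" if f: "smooth_at p f" for c p f
  proof -
    have "smooth_at p (\<lambda>x. c * f x)" by (rule smooth_at_mult[OF smooth_at_const f])
    then show ?thesis
      using scale2[OF XY f, of c] scale2[OF XY(2,1) f, of c] f by (simp add: B_def algebra_simps)
  qed
  have addB: "B (\<lambda>x. f x + g x) p = B f p + B g p" if fg: "smooth_at p f" "smooth_at p g" for p f g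
    using add2[OF XY fg] add2[OF XY(2,1) fg] smooth_at_add[OF fg] fg by (simp add: B_def)
  have multB: "B (\<lambda>x. f x * g x) p = f p * B g p + g p * B f p"
    if fg: "smooth_at p f" "smooth_at p g" for p f g
    using mult2[OF XY fg] mult2[OF XY(2,1) fg] smooth_at_mult[OF fg] fg
    by (simp add: B_def algebra_simps)
  have tB: "tangent_vector p (\<lambda>f. B f p)" for p
    unfolding tangent_vector_def
  proof (intro conjI allI impI)
    show "B f p = 0" if "\<not> smooth_at p f" for f
      using that by (simp add: B_def)
  qed (rule addB scaleB multB; assumption)+
  have sB: "smooth_fun_on W (B f)" if W: "open W" "smooth_fun_on W f" for W f
  proof -
    have s: "smooth_fun_on W (Z h)" if "Z \<in> VF" "smooth_fun_on W h" for Z h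
      using that W(1) unfolding VF_def smooth_vector_field_def by blast
    have "smooth_fun_on W (X (Y f))" "smooth_fun_on W (Y (X f))"
      by (rule s[OF XY(1) s[OF XY(2) W(2)]], rule s[OF XY(2) s[OF XY(1) W(2)]])
    then have "smooth_fun_on W (\<lambda>p. X (Y f) p + (-1) * Y (X f) p)"
      using smooth_fun_on_add[OF W(1) _ smooth_fun_on_scale[OF W(1)]] by blast
    moreover have "X (Y f) p + (-1) * Y (X f) p = B f p" if "p \<in> W" for p
    proof -
      have "smooth_at p f" using that W unfolding smooth_at_def by blast
      then show ?thesis by (simp add: B_def)
    qed
    ultimately show ?thesis
      by (rule smooth_fun_on_congI[OF W(1), rotated])
  qed
  have lB: "left_invariant B"
  proof -
    have l: "Z f (a + p) = Z (\<lambda>x. f (a + x)) p" if "Z \<in> VF" for Z f a p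
    proof -
      have "left_invariant Z" using that by (simp add: VF_def)
      then show ?thesis by (rule left_invariant_def[THEN iffD1, rule_format])
    qed
    have ll: "Z (Z' f) (a + p) = Z (Z' (\<lambda>x. f (a + x))) p" if "Z \<in> VF" "Z' \<in> VF" for Z Z' f a p
    proof -
      have "Z (Z' f) (a + p) = Z (\<lambda>x. Z' f (a + x)) p"
        by (rule l[OF that(1)])
      also have "(\<lambda>x. Z' f (a + x)) = Z' (\<lambda>x. f (a + x))"
        by (rule ext) (rule l[OF that(2)])
      finally show ?thesis .
    qed
    show ?thesis
      unfolding left_invariant_def B_def smooth_at_translate ll[OF XY] ll[OF XY(2,1)] by (intro allI refl)
  qed
  have "smooth_vector_field B \<and> left_invariant B"
    unfolding smooth_vector_field_def by (intro conjI allI impI tB sB lB)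
  then show "smooth_vector_field (\<lambda>f p. if smooth_at p f then X (Y f) p - Y (X f) p else 0) \<and>
      left_invariant (\<lambda>f p. if smooth_at p f then X (Y f) p - Y (X f) p else 0)"
    unfolding B_def .
qed

definition almost_abelian :: "'g::lie_group6 itself \<Rightarrow> bool" where
  "almost_abelian _ \<longleftrightarrow> (\<exists>\<hh> :: 'g lie_algebra set.
     subspace \<hh> \<and> dim \<hh> + 1 = dim (UNIV :: 'g lie_algebra set) \<and>
     (\<forall>x. \<forall>y\<in>\<hh>. lie_bracket x y \<in> \<hh>) \<and>
     (\<forall>x\<in>\<hh>. \<forall>y\<in>\<hh>. lie_bracket x y = 0))"

section \<open>Left-invariant forms\<close>

text \<open>
  A left-invariant tensor field is identified with the multilinear map that it induces on
  left-invariant vector fields.  A \<open>k\<close>-form is a function of lists of vectors of which only the values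
  on lists of length \<open>k\<close> matter.
\<close>

definition alternating_form :: "nat \<Rightarrow> ('v::real_vector list \<Rightarrow> 'b::real_vector) \<Rightarrow> bool" where
  "alternating_form k \<alpha> \<longleftrightarrow>
     (\<forall>xs i. length xs = k \<longrightarrow> i < k \<longrightarrow> linear (\<lambda>x. \<alpha> (xs[i := x]))) \<and>
     (\<forall>xs i j. length xs = k \<longrightarrow> i < j \<longrightarrow> j < k \<longrightarrow> xs ! i = xs ! j \<longrightarrow> \<alpha> xs = 0)"

abbreviation two_form :: "('v \<Rightarrow> 'v \<Rightarrow> 'b) \<Rightarrow> 'v list \<Rightarrow> 'b" where
  "two_form \<omega> \<equiv> \<lambda>xs. \<omega> (xs ! 0) (xs ! 1)"

definition wedge ::
    "nat \<Rightarrow> nat \<Rightarrow> ('v list \<Rightarrow> real) \<Rightarrow> ('v list \<Rightarrow> real) \<Rightarrow> 'v list \<Rightarrow> real" where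
  "wedge p q \<alpha> \<beta> xs =
     (\<Sum>\<sigma> | \<sigma> permutes {..<p + q}. of_int (sign \<sigma>) *
        \<alpha> (map (\<lambda>i. xs ! \<sigma> i) [0..<p]) * \<beta> (map (\<lambda>i. xs ! \<sigma> i) [p..<p + q]))
     / (fact p * fact q)"

text \<open>
  The terms \<open>X\<^sub>i (\<alpha> (\<dots>))\<close> of the invariant formula for the exterior derivative are absent,
  because a left-invariant form is constant on left-invariant vector fields.
\<close>

definition ext_deriv ::
    "('g::lie_group6 lie_algebra list \<Rightarrow> 'b::real_vector) \<Rightarrow> 'g lie_algebra list \<Rightarrow> 'b" where
  "ext_deriv \<alpha> xs =
     (\<Sum>(i, j) | i < j \<and> j < length xs.
        (-1) ^ (i + j) *\<^sub>R \<alpha> (lie_bracket (xs ! i) (xs ! j) # nths xs (- {i, j})))"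

text \<open>
  The \<open>(p, q)\<close>-component with respect to \<open>J\<close>: the sum over the sets \<open>S\<close> of \<open>p\<close> slots of the
  complex multilinear extension of \<open>\<alpha>\<close>, with \<open>(x - \<i> J x) / 2\<close> inserted in the slots in \<open>S\<close> and
  \<open>(x + \<i> J x) / 2\<close> in the others.  Expanding by multilinearity, \<open>T\<close> is the set of slots
  which receive \<open>J x\<close>.
\<close>

definition type_part ::
    "('v \<Rightarrow> 'v) \<Rightarrow> nat \<Rightarrow> nat \<Rightarrow> ('v list \<Rightarrow> complex) \<Rightarrow> 'v list \<Rightarrow> complex" where
  "type_part J p q \<alpha> xs =
     (\<Sum>S | S \<subseteq> {..<p + q} \<and> card S = p. \<Sum>T\<in>Pow {..<p + q}.
        (\<Prod>t\<in>T. if t \<in> S then - \<i> else \<i>) *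
        \<alpha> (map (\<lambda>j. if j \<in> T then J (xs ! j) else xs ! j) [0..<p + q]))
     / 2 ^ (p + q)"

section \<open>Left-invariant Hermitian structures\<close>

definition complex_structure :: "('g::lie_group6 lie_algebra \<Rightarrow> 'g lie_algebra) \<Rightarrow> bool" where
  "complex_structure J \<longleftrightarrow> linear J \<and> (\<forall>x. J (J x) = - x) \<and>
     (\<forall>x y. lie_bracket (J x) (J y) - J (lie_bracket (J x) y) - J (lie_bracket x (J y))
        - lie_bracket x y = 0)"

definition metric :: "('v \<Rightarrow> 'v \<Rightarrow> real) \<Rightarrow> ('v \<Rightarrow> 'v) \<Rightarrow> 'v \<Rightarrow> 'v \<Rightarrow> real" where
  "metric \<omega> J x y = \<omega> x (J y)"

definition hermitian_structure ::
    "('g::lie_group6 lie_algebra \<Rightarrow> 'g lie_algebra \<Rightarrow> real) \<Rightarrow> ('g lie_algebra \<Rightarrow> 'g lie_algebra) \<Rightarrow> bool" where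
  "hermitian_structure \<omega> J \<longleftrightarrow>
     complex_structure J \<and> alternating_form 2 (two_form \<omega>) \<and>
     (\<forall>x y. \<omega> (J x) (J y) = \<omega> x y) \<and> (\<forall>x. x \<noteq> 0 \<longrightarrow> metric \<omega> J x x > 0)"

definition balanced :: "('g::lie_group6 lie_algebra \<Rightarrow> 'g lie_algebra \<Rightarrow> real) \<Rightarrow> bool" where
  "balanced \<omega> \<longleftrightarrow>
     (\<forall>xs. length xs = 5 \<longrightarrow> ext_deriv (wedge 2 2 (two_form \<omega>) (two_form \<omega>)) xs = 0)"

definition kahler :: "('g::lie_group6 lie_algebra \<Rightarrow> 'g lie_algebra \<Rightarrow> real) \<Rightarrow> bool" where
  "kahler \<omega> \<longleftrightarrow> (\<forall>xs. length xs = 3 \<longrightarrow> ext_deriv (two_form \<omega>) xs = 0)"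

text \<open>
  Holomorphic means \<open>\<partial>\<close>-bar closed, and \<open>\<partial>\<close>-bar of a \<open>(3, 0)\<close>-form is the \<open>(3, 1)\<close>-component of its
  exterior derivative.  A left-invariant form vanishes nowhere as soon as it is not zero.
\<close>

definition holomorphic_volume_form ::
    "('g::lie_group6 lie_algebra \<Rightarrow> 'g lie_algebra) \<Rightarrow> ('g lie_algebra list \<Rightarrow> complex) \<Rightarrow> bool" where
  "holomorphic_volume_form J \<Psi> \<longleftrightarrow>
     alternating_form 3 \<Psi> \<and>
     (\<forall>xs. length xs = 3 \<longrightarrow> type_part J 3 0 \<Psi> xs = \<Psi> xs) \<and>
     (\<forall>xs. length xs = 4 \<longrightarrow> type_part J 3 1 (ext_deriv \<Psi>) xs = 0) \<and>
     (\<exists>xs. length xs = 3 \<and> \<Psi> xs \<noteq> 0)"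

section \<open>Left-invariant connections\<close>

text \<open>
  \<open>D x y\<close> is the covariant derivative of \<open>y\<close> in the direction \<open>x\<close>.  All connections canonically
  attached to a left-invariant Hermitian structure are left-invariant, so they are given by a
  bilinear map on left-invariant vector fields.
\<close>

definition torsion ::
    "('g::lie_group6 lie_algebra \<Rightarrow> 'g lie_algebra \<Rightarrow> 'g lie_algebra) \<Rightarrow>
     'g lie_algebra \<Rightarrow> 'g lie_algebra \<Rightarrow> 'g lie_algebra" where
  "torsion D x y = D x y - D y x - lie_bracket x y"

definition curvature ::
    "('g::lie_group6 lie_algebra \<Rightarrow> 'g lie_algebra \<Rightarrow> 'g lie_algebra) \<Rightarrow>
     'g lie_algebra \<Rightarrow> 'g lie_algebra \<Rightarrow> 'g lie_algebra \<Rightarrow> 'g lie_algebra" where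
  "curvature D x y z = D x (D y z) - D y (D x z) - D (lie_bracket x y) z"

definition flat :: "('g::lie_group6 lie_algebra \<Rightarrow> 'g lie_algebra \<Rightarrow> 'g lie_algebra) \<Rightarrow> bool" where
  "flat D \<longleftrightarrow> (\<forall>x y z. curvature D x y z = 0)"

definition hermitian_connection ::
    "('v::real_vector \<Rightarrow> 'v \<Rightarrow> real) \<Rightarrow> ('v \<Rightarrow> 'v) \<Rightarrow> ('v \<Rightarrow> 'v \<Rightarrow> 'v) \<Rightarrow> bool" where
  "hermitian_connection \<omega> J D \<longleftrightarrow>
     bilinear D \<and>
     (\<forall>x y. D x (J y) = J (D x y)) \<and>
     (\<forall>x y z. metric \<omega> J (D x y) z + metric \<omega> J y (D x z) = 0)"

text \<open>The Chern connection is the Hermitian connection whose torsion has no \<open>(1, 1)\<close>-component.\<close>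

definition chern_connection ::
    "('g::lie_group6 lie_algebra \<Rightarrow> 'g lie_algebra \<Rightarrow> real) \<Rightarrow> ('g lie_algebra \<Rightarrow> 'g lie_algebra) \<Rightarrow>
     ('g lie_algebra \<Rightarrow> 'g lie_algebra \<Rightarrow> 'g lie_algebra) \<Rightarrow> bool" where
  "chern_connection \<omega> J D \<longleftrightarrow>
     hermitian_connection \<omega> J D \<and>
     (\<forall>w xs. length xs = 2 \<longrightarrow>
        type_part J 1 1 (two_form (\<lambda>x y. complex_of_real (metric \<omega> J (torsion D x y) w))) xs = 0)"

definition bismut_connection ::
    "('g::lie_group6 lie_algebra \<Rightarrow> 'g lie_algebra \<Rightarrow> real) \<Rightarrow> ('g lie_algebra \<Rightarrow> 'g lie_algebra) \<Rightarrow>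
     ('g lie_algebra \<Rightarrow> 'g lie_algebra \<Rightarrow> 'g lie_algebra) \<Rightarrow> bool" where
  "bismut_connection \<omega> J D \<longleftrightarrow>
     hermitian_connection \<omega> J D \<and>
     alternating_form 3 (\<lambda>xs. metric \<omega> J (torsion D (xs ! 0) (xs ! 1)) (xs ! 2))"

definition gauduchon_connection ::
    "('g::lie_group6 lie_algebra \<Rightarrow> 'g lie_algebra \<Rightarrow> real) \<Rightarrow> ('g lie_algebra \<Rightarrow> 'g lie_algebra) \<Rightarrow>
     real \<Rightarrow> ('g lie_algebra \<Rightarrow> 'g lie_algebra \<Rightarrow> 'g lie_algebra) \<Rightarrow> bool" where
  "gauduchon_connection \<omega> J \<tau> D \<longleftrightarrow>
     (\<exists>C B. chern_connection \<omega> J C \<and> bismut_connection \<omega> J B \<and>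
        D = (\<lambda>x y. ((1 + \<tau>) / 2) *\<^sub>R C x y + ((1 - \<tau>) / 2) *\<^sub>R B x y))"

text \<open>The conditions on the endomorphism-valued curvature are imposed on all of its matrix coefficients.\<close>

definition curvature_coeff ::
    "('g::lie_group6 lie_algebra \<Rightarrow> 'g lie_algebra \<Rightarrow> real) \<Rightarrow> ('g lie_algebra \<Rightarrow> 'g lie_algebra) \<Rightarrow>
     ('g lie_algebra \<Rightarrow> 'g lie_algebra \<Rightarrow> 'g lie_algebra) \<Rightarrow> 'g lie_algebra \<Rightarrow> 'g lie_algebra \<Rightarrow>
     'g lie_algebra list \<Rightarrow> real" where
  "curvature_coeff \<omega> J D z w xs = metric \<omega> J (curvature D (xs ! 0) (xs ! 1) z) w"

definition instanton ::
    "('g::lie_group6 lie_algebra \<Rightarrow> 'g lie_algebra \<Rightarrow> real) \<Rightarrow> ('g lie_algebra \<Rightarrow> 'g lie_algebra) \<Rightarrow>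
     ('g lie_algebra \<Rightarrow> 'g lie_algebra \<Rightarrow> 'g lie_algebra) \<Rightarrow> bool" where
  "instanton \<omega> J D \<longleftrightarrow> (\<forall>z w.
     (\<forall>xs. length xs = 6 \<longrightarrow>
        wedge 4 2 (wedge 2 2 (two_form \<omega>) (two_form \<omega>)) (curvature_coeff \<omega> J D z w) xs = 0) \<and>
     (\<forall>xs. length xs = 2 \<longrightarrow>
        type_part J 2 0 (\<lambda>ys. complex_of_real (curvature_coeff \<omega> J D z w ys)) xs = 0) \<and>
     (\<forall>xs. length xs = 2 \<longrightarrow>
        type_part J 0 2 (\<lambda>ys. complex_of_real (curvature_coeff \<omega> J D z w ys)) xs = 0))"

end

theory Submission
  imports Defs
begin

text \<open>
  Let \<open>v\<close> be a unit vector orthogonal to the abelian ideal of codimension one and let \<open>A = ad v\<close>.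
  All brackets are determined by \<open>A\<close>: \<open>[x, y] = g(v, x) A y - g(v, y) A x\<close>.  Integrability of \<open>J\<close>
  makes \<open>A\<close> preserve the complex orthogonal complement of \<open>v\<close> and commute with \<open>J\<close> there.  The balanced
  condition makes \<open>J v\<close> an eigenvector of \<open>A\<close> and \<open>A\<close> trace-free on that complement; a holomorphic volume
  form relates the eigenvalue to the trace, so that \<open>A (J v) = 0\<close> (lemma \<open>normal_form\<close>).  Thus \<open>A\<close> commutes
  with \<open>J\<close> on the whole Lie algebra, and so do its symmetric part \<open>S\<close> and its skew part \<open>K\<close>.

  The metric is Kaehler exactly when \<open>S = 0\<close>.  A Hermitian connection is determined by the torsion
  condition that defines the Chern or the Bismut connection, so both connections, and with them
  \<open>\<nabla>\<^sup>\<tau>\<close>, can be written down in terms of \<open>S\<close> and \<open>K\<close>.  Let \<open>e\<close>, \<open>f\<close> be a unitary basis of the complement.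
  The equation \<open>\<omega>\<^sup>2 \<and> \<Omega> = 0\<close> says that \<open>\<Omega>(v, J v) + \<Omega>(e, J e) + \<Omega>(f, J f) = 0\<close>.  Applied to \<open>v\<close> and paired with
  \<open>J v\<close>, the left-hand side is \<open>- (1 - \<tau>)\<^sup>2 / 2\<close> times \<open>|S e|\<^sup>2 + |S f|\<^sup>2\<close>.  For \<open>\<tau> \<noteq> 1\<close> an instanton
  therefore has \<open>S = 0\<close>; then \<open>\<nabla>\<^sub>x = g(v, x) K\<close>, which is flat because all values of the connection commute and
  brackets are orthogonal to \<open>v\<close>.  For \<open>\<tau> = 1\<close> the curvature is a scalar 2-form supported on the plane
  of \<open>v\<close> and \<open>J v\<close>, times \<open>J [K, S]\<close>; the trace equation kills \<open>[K, S]\<close>, and with it the curvature.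

  Since left-invariant vector fields are derivations here, that the Lie algebra has dimension at most six
  is a theorem: it is Hadamard's lemma (\<open>tangent_vector_eq_0I\<close>).  The existence of a volume form
  gives the lower bound.  The upper bound is essential: the product of the hyperbolic plane with complex
  3-space is Kaehler and almost abelian, and carries a parallel \<open>(3, 0)\<close>-form, but its Levi-Civita
  connection is not an instanton.
\<close>

section \<open>The dimension of the Lie algebra\<close>

lemma Ck_on_imp_continuous_on: "Ck_on k S f \<Longrightarrow> continuous_on S f"
proof (induction k)
  case (Suc k)
  then show ?case using Ck_on_SucD by blast
qed simp

text \<open>
  Differentiating under the integral sign turns the weight \<open>t ^ m\<close> into \<open>t ^ Suc m\<close>; this is why the
  statement, and the induction on \<open>k\<close>, is about all weights at once.
\<close>

lemma Ck_on_ray_integral: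
  fixes f :: "'a::euclidean_space \<Rightarrow> real"
  assumes S: "open S" "convex S" "c \<in> S" and f: "Ck_on k S f"
  shows "Ck_on k S (\<lambda>x. integral {0..1} (\<lambda>t. t ^ m * f (c + t *\<^sub>R (x - c))))"
proof -
  have ray: "c + t *\<^sub>R (x - c) \<in> S" if "x \<in> S" "t \<in> {0..1}" for x t
    using convexD_alt[OF S(2,3) that(1), of t] that(2) by (simp add: algebra_simps)
  have cont_ray: "continuous_on (S \<times> {0..1}) (\<lambda>p. h (c + snd p *\<^sub>R (fst p - c)))"
    if "continuous_on S h" for h :: "'a \<Rightarrow> real"
    by (rule continuous_on_compose2[OF that]) (use ray in \<open>auto intro!: continuous_intros\<close>)
  show ?thesis
    using f
  proof (induction k arbitrary: f m)
    case 0
    have "continuous_on (S \<times> cbox 0 1) (\<lambda>(x, t). t ^ m * f (c + t *\<^sub>R (x - c)))"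
      unfolding split_beta cbox_interval using 0 by (intro continuous_intros cont_ray) simp
    then show ?case
      using integral_continuous_on_param[of S 0 "1::real" "\<lambda>x t. t ^ m * f (c + t *\<^sub>R (x - c))"]
      by (simp add: cbox_interval)
  next
    case (Suc k)
    obtain f' where f': "\<And>x. x \<in> S \<Longrightarrow> (f has_derivative f' x) (at x)"
      "\<And>v. Ck_on k S (\<lambda>x. f' x v)"
      using Ck_on_SucE[OF Suc.prems] by blast
    have blin: "bounded_linear (f' x)" if "x \<in> S" for x
      using f'(1)[OF that] has_derivative_bounded_linear by blast
    define F where "F x t = t ^ Suc m *\<^sub>R Blinfun (f' (c + t *\<^sub>R (x - c)))" for x t
    have F_apply: "blinfun_apply (F x t) v = t ^ Suc m * f' (c + t *\<^sub>R (x - c)) v"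
      if "x \<in> S" "t \<in> {0..1}" for x t v
      using bounded_linear_Blinfun_apply[OF blin[OF ray[OF that]]]
      by (simp add: F_def scaleR_blinfun.rep_eq)
    have contF: "continuous_on (S \<times> {0..1}) (\<lambda>p. F (fst p) (snd p))"
    proof (rule continuous_on_blinfun_componentwise)
      fix i :: 'a
      have "continuous_on (S \<times> {0..1::real})
          (\<lambda>p. snd p ^ Suc m * f' (c + snd p *\<^sub>R (fst p - c)) i)"
        by (intro continuous_intros cont_ray) (rule Ck_on_imp_continuous_on[OF f'(2)])
      then show "continuous_on (S \<times> {0..1}) (\<lambda>p. blinfun_apply (F (fst p) (snd p)) i)"
        by (rule continuous_on_eq) (auto simp: F_apply)
    qed
    show ?case
    proof (rule Ck_on_SucI[OF S(1),
          where f' = "\<lambda>x v. integral {0..1} (\<lambda>t. t ^ Suc m * f' (c + t *\<^sub>R (x - c)) v)"])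
      show "Ck_on k S (\<lambda>x. integral {0..1} (\<lambda>t. t ^ Suc m * f' (c + t *\<^sub>R (x - c)) v))" for v
        by (rule Suc.IH) (rule f'(2))
      fix x assume x: "x \<in> S"
      have contFx: "continuous_on {0..1} (F x)"
        by (rule continuous_on_compose2[OF contF, of _ "\<lambda>t. (x, t)", simplified])
           (use x in \<open>auto intro!: continuous_intros\<close>)
      have "((\<lambda>x. integral (cbox 0 1) (\<lambda>t. t ^ m * f (c + t *\<^sub>R (x - c))))
          has_derivative integral (cbox 0 1) (F x)) (at x within S)"
      proof (rule leibniz_rule[OF _ _ _ x S(2)])
        fix y and t :: real assume y: "y \<in> S" "t \<in> cbox 0 1"
        then have t: "t \<in> {0..1}" by (simp add: cbox_interval)
        have "((\<lambda>y. t ^ m * f (c + t *\<^sub>R (y - c))) has_derivative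
            (\<lambda>v. t ^ m * f' (c + t *\<^sub>R (y - c)) (t *\<^sub>R v))) (at y)"
          by (rule has_derivative_mult_right)
             (rule has_derivative_compose[where f = "\<lambda>y. c + t *\<^sub>R (y - c)" and g = f, OF _ f'(1)[OF ray[OF y(1) t]]],
               auto intro!: derivative_eq_intros)
        moreover have "t ^ m * f' (c + t *\<^sub>R (y - c)) (t *\<^sub>R v) = blinfun_apply (F y t) v" for v
          using linear_scale[OF bounded_linear.linear[OF blin[OF ray[OF y(1) t]]]]
          by (simp add: F_apply[OF y(1) t])
        ultimately show "((\<lambda>y. t ^ m * f (c + t *\<^sub>R (y - c))) has_derivative blinfun_apply (F y t))
            (at y within S)"
          by (simp add: has_derivative_at_withinI)
      next
        fix y assume y: "y \<in> S"
        have "continuous_on {0..1} (\<lambda>t. f (c + t *\<^sub>R (y - c)))"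
          by (rule continuous_on_compose2[OF Ck_on_imp_continuous_on[OF Suc.prems]])
             (use ray y in \<open>auto intro!: continuous_intros\<close>)
        then show "(\<lambda>t. t ^ m * f (c + t *\<^sub>R (y - c))) integrable_on cbox 0 1"
          unfolding cbox_interval by (intro integrable_continuous_real continuous_intros)
      next
        show "continuous_on (S \<times> cbox 0 1) (\<lambda>(x, t). F x t)"
          using contF by (simp add: split_beta cbox_interval)
      qed
      moreover have "blinfun_apply (integral {0..1} (F x))
          = (\<lambda>v. integral {0..1} (\<lambda>t. t ^ Suc m * f' (c + t *\<^sub>R (x - c)) v))"
      proof
        fix v
        have "bounded_linear (\<lambda>b::'a \<Rightarrow>\<^sub>L real. blinfun_apply b v)"
          by (rule bounded_bilinear.bounded_linear_left[OF bounded_bilinear_blinfun_apply])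
        from integral_linear[OF integrable_continuous_real[OF contFx] this]
        have "blinfun_apply (integral {0..1} (F x)) v = integral {0..1} (\<lambda>t. blinfun_apply (F x t) v)"
          by (simp add: o_def)
        also have "\<dots> = integral {0..1} (\<lambda>t. t ^ Suc m * f' (c + t *\<^sub>R (x - c)) v)"
          by (rule integral_cong) (rule F_apply[OF x])
        finally show "blinfun_apply (integral {0..1} (F x)) v = \<dots>" .
      qed
      ultimately show "((\<lambda>x. integral {0..1} (\<lambda>t. t ^ m * f (c + t *\<^sub>R (x - c)))) has_derivative
          (\<lambda>v. integral {0..1} (\<lambda>t. t ^ Suc m * f' (c + t *\<^sub>R (x - c)) v))) (at x)"
        by (simp add: cbox_interval at_within_open[OF x S(1)])
    qed
  qed
qed

text \<open>
  The fundamental theorem of calculus on the segment from \<open>c\<close> to \<open>x\<close>: the factors are the averages of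
  the partial derivatives of \<open>f\<close> over that segment.
\<close>

lemma hadamard:
  fixes f :: "'a::euclidean_space \<Rightarrow> real"
  assumes S: "open S" "convex S" "c \<in> S" and f: "smooth_on S f"
  obtains g where "\<And>b. smooth_on S (g b)"
    "\<And>x. x \<in> S \<Longrightarrow> f x = f c + (\<Sum>b\<in>Basis. ((x - c) \<bullet> b) * g b x)"
proof
  define f' where "f' x = frechet_derivative f (at x)" for x
  have "Ck_on (Suc k) S f" for k
    using f by (simp add: smooth_on_def del: Ck_on.simps)
  then have f': "\<And>x. x \<in> S \<Longrightarrow> (f has_derivative f' x) (at x)" "\<And>k v. Ck_on k S (\<lambda>x. f' x v)"
    by (auto simp: f'_def frechet_derivative_works)
  define g where "g b x = integral {0..1} (\<lambda>t. t ^ 0 * f' (c + t *\<^sub>R (x - c)) b)" for b x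
  show "smooth_on S (g b)" for b
    unfolding smooth_on_def g_def by (intro allI Ck_on_ray_integral S f'(2))
  fix x assume x: "x \<in> S"
  have ray: "c + t *\<^sub>R (x - c) \<in> S" if "t \<in> {0..1}" for t
    using convexD_alt[OF S(2,3) x, of t] that by (simp add: algebra_simps)
  have int: "(\<lambda>t. f' (c + t *\<^sub>R (x - c)) b) integrable_on {0..1}" for b
    by (intro integrable_continuous_real
          continuous_on_compose2[OF Ck_on_imp_continuous_on[OF f'(2)[of 0]]])
       (use ray in \<open>auto intro!: continuous_intros\<close>)
  have "((\<lambda>t. f' (c + t *\<^sub>R (x - c)) (x - c)) has_integral f (c + 1 *\<^sub>R (x - c)) - f (c + 0 *\<^sub>R (x - c))) {0..1}"
  proof (rule fundamental_theorem_of_calculus)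
    fix t :: real assume t: "t \<in> {0..1}"
    have "((\<lambda>t. f (c + t *\<^sub>R (x - c))) has_derivative
        (\<lambda>s. f' (c + t *\<^sub>R (x - c)) (s *\<^sub>R (x - c)))) (at t)"
      by (rule has_derivative_compose[where f = "\<lambda>t. c + t *\<^sub>R (x - c)" and g = f,
            OF _ f'(1)[OF ray[OF t]]]) (auto intro!: derivative_eq_intros)
    then have "((\<lambda>t. f (c + t *\<^sub>R (x - c))) has_derivative
        (\<lambda>s. s *\<^sub>R f' (c + t *\<^sub>R (x - c)) (x - c))) (at t)"
      using linear_scale[OF has_derivative_linear[OF f'(1)[OF ray[OF t]]]] by simp
    then show "((\<lambda>t. f (c + t *\<^sub>R (x - c))) has_vector_derivative f' (c + t *\<^sub>R (x - c)) (x - c))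
        (at t within {0..1})"
      unfolding has_vector_derivative_def by (rule has_derivative_at_withinI)
  qed simp
  then have "f x - f c = integral {0..1} (\<lambda>t. f' (c + t *\<^sub>R (x - c)) (x - c))"
    by (simp add: integral_unique)
  also have "\<dots> = integral {0..1} (\<lambda>t. \<Sum>b\<in>Basis. ((x - c) \<bullet> b) * f' (c + t *\<^sub>R (x - c)) b)"
  proof (rule integral_cong)
    fix t :: real assume t: "t \<in> {0..1}"
    note lin = has_derivative_linear[OF f'(1)[OF ray[OF t]]]
    have "f' (c + t *\<^sub>R (x - c)) (\<Sum>b\<in>Basis. ((x - c) \<bullet> b) *\<^sub>R b)
        = (\<Sum>b\<in>Basis. ((x - c) \<bullet> b) * f' (c + t *\<^sub>R (x - c)) b)"
      by (simp only: linear_sum[OF lin] linear_cmul[OF lin] real_scaleR_def)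
    then show "f' (c + t *\<^sub>R (x - c)) (x - c)
        = (\<Sum>b\<in>Basis. ((x - c) \<bullet> b) * f' (c + t *\<^sub>R (x - c)) b)"
      by (simp only: euclidean_representation)
  qed
  also have "\<dots> = (\<Sum>b\<in>Basis. ((x - c) \<bullet> b) * g b x)"
    unfolding g_def using int by (subst integral_sum) (auto intro!: integrable_on_mult_right)
  finally show "f x = f c + (\<Sum>b\<in>Basis. ((x - c) \<bullet> b) * g b x)" by simp
qed

text \<open>
  Carries the coordinates and the factors from Hadamard's lemma, which live on an open set of
  Euclidean space, to smooth functions on the group.
\<close>

lemma smooth_at_chart_compose:
  fixes U :: "'g::lie_group6 set"
  assumes U: "(U, \<phi>) \<in> atlas" and T: "open T" "T \<subseteq> \<phi> ` U" and h: "smooth_on T h"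
    and p: "p \<in> U" "\<phi> p \<in> T"
  shows "smooth_at p (\<lambda>x. h (\<phi> x))"
  unfolding smooth_at_def
proof (intro exI conjI)
  let ?W = "{x \<in> U. \<phi> x \<in> T}"
  have "\<phi> ` ?W = T" using T(2) by auto
  then show W: "open ?W" using atlas_homeo[OF U, of ?W] T(1) by auto
  show "p \<in> ?W" using p by simp
  show "smooth_fun_on ?W (\<lambda>x. h (\<phi> x))"
    unfolding smooth_fun_on_def smooth_on_def
  proof safe
    fix V :: "'g set" and \<psi> k assume V: "(V, \<psi>) \<in> atlas"
    have "Ck_on k (\<psi> ` (V \<inter> U)) (\<lambda>u. \<phi> (inv_into V \<psi> u))"
      using atlas_smooth[OF V U] by (simp add: smooth_on_def)
    then have "Ck_on k (\<psi> ` (V \<inter> ?W)) (\<lambda>u. \<phi> (inv_into V \<psi> u))"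
      by (rule Ck_on_subset) auto
    moreover have "Ck_on k T h" using h by (simp add: smooth_on_def)
    ultimately show "Ck_on k (\<psi> ` (V \<inter> ?W)) (\<lambda>u. h (\<phi> (inv_into V \<psi> u)))"
      by (rule Ck_on_compose[OF open_chart_image[OF V W]]) (use atlas_inj[OF V] in auto)
  qed
qed

lemma tangent_vector_add:
  "tangent_vector p D \<Longrightarrow> smooth_at p f \<Longrightarrow> smooth_at p g \<Longrightarrow> D (\<lambda>x. f x + g x) = D f + D g"
  unfolding tangent_vector_def by blast

lemma tangent_vector_mult:
  "tangent_vector p D \<Longrightarrow> smooth_at p f \<Longrightarrow> smooth_at p g \<Longrightarrow>
    D (\<lambda>x. f x * g x) = f p * D g + g p * D f"
  unfolding tangent_vector_def by blast

lemma tangent_vector_const: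
  assumes D: "tangent_vector p D"
  shows "D (\<lambda>_. c) = 0"
proof -
  have "D (\<lambda>x. 1 * 1) = 1 * D (\<lambda>_. 1) + 1 * D (\<lambda>_. 1)"
    using D smooth_at_const[of p 1] unfolding tangent_vector_def by blast
  then have "D (\<lambda>_. 1) = 0" by simp
  moreover have "D (\<lambda>x. c * 1) = c * D (\<lambda>_. 1)"
    using D smooth_at_const[of p 1] unfolding tangent_vector_def by blast
  ultimately show ?thesis by simp
qed

lemma tangent_vector_sum:
  assumes D: "tangent_vector p D" and f: "\<And>i. i \<in> I \<Longrightarrow> smooth_at p (f i)" and I: "finite I"
  shows "smooth_at p (\<lambda>x. \<Sum>i\<in>I. f i x) \<and> D (\<lambda>x. \<Sum>i\<in>I. f i x) = (\<Sum>i\<in>I. D (f i))"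
  using I f
proof (induction I rule: finite_induct)
  case empty
  then show ?case by (simp add: smooth_at_const tangent_vector_const[OF D])
next
  case (insert i I)
  then have "smooth_at p (f i)" "smooth_at p (\<lambda>x. \<Sum>i\<in>I. f i x)"
    "D (\<lambda>x. \<Sum>i\<in>I. f i x) = (\<Sum>i\<in>I. D (f i))" by auto
  moreover from this have "D (\<lambda>x. f i x + (\<Sum>i\<in>I. f i x)) = D (f i) + D (\<lambda>x. \<Sum>i\<in>I. f i x)"
    using D unfolding tangent_vector_def by blast
  ultimately show ?case using insert.hyps by (simp add: smooth_at_add)
qed

text \<open>
  By Hadamard's lemma, \<open>f - f p\<close> is near \<open>p\<close> a sum of products of a coordinate difference, which vanishes
  at \<open>p\<close> and is killed by \<open>D\<close>, with a smooth function.  The Leibniz rule kills each product.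
\<close>

lemma tangent_vector_eq_0I:
  fixes p :: "'g::lie_group6"
  assumes D: "tangent_vector p D" and U: "(U, \<phi>) \<in> atlas" "p \<in> U"
    and coords: "\<And>b. b \<in> Basis \<Longrightarrow> D (\<lambda>x. \<phi> x \<bullet> b) = 0"
  shows "D f = 0"
proof (cases "smooth_at p f")
  case False
  then show ?thesis using D by (simp add: tangent_vector_def)
next
  case True
  then obtain W where W: "open W" "p \<in> W" "smooth_fun_on W f"
    unfolding smooth_at_def by blast
  have "open (\<phi> ` (U \<inter> W))" by (rule open_chart_image[OF U(1) W(1)])
  moreover have "\<phi> p \<in> \<phi> ` (U \<inter> W)" using U(2) W(2) by blast
  ultimately obtain r where r: "r > 0" "ball (\<phi> p) r \<subseteq> \<phi> ` (U \<inter> W)"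
    by (meson open_contains_ball)
  let ?T = "ball (\<phi> p) r"
  have T: "open ?T" "?T \<subseteq> \<phi> ` U" "\<phi> p \<in> ?T" using r by auto
  have "smooth_on ?T (\<lambda>u. f (inv_into U \<phi> u))"
    using W(3) U(1) r(2) Ck_on_subset unfolding smooth_fun_on_def smooth_on_def by blast
  from hadamard[OF T(1) convex_ball T(3) this] obtain g where g: "\<And>b. smooth_on ?T (g b)"
    "\<And>u. u \<in> ?T \<Longrightarrow> f (inv_into U \<phi> u)
      = f (inv_into U \<phi> (\<phi> p)) + (\<Sum>b\<in>Basis. ((u - \<phi> p) \<bullet> b) * g b u)"
    by blast
  note smooth_chart = smooth_at_chart_compose[OF U(1) T(1,2) _ U(2) T(3)]
  have g_smooth: "smooth_at p (\<lambda>x. g b (\<phi> x))" for b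
    by (rule smooth_chart) (rule g(1))
  have b_smooth: "smooth_at p (\<lambda>x. \<phi> x \<bullet> b)" for b
  proof (rule smooth_chart)
    show "smooth_on ?T (\<lambda>u. u \<bullet> b)"
      unfolding smooth_on_def
      by (intro allI Ck_on_bounded_linear bounded_linear_inner_left open_ball)
  qed
  let ?x = "\<lambda>b x. \<phi> x \<bullet> b + - (\<phi> p \<bullet> b)" and ?c = "\<lambda>_. f p"
  have x_smooth: "smooth_at p (?x b)" for b
    by (intro smooth_at_add b_smooth smooth_at_const)
  have D_x: "D (?x b) = 0" if "b \<in> Basis" for b
  proof -
    have "D (?x b) = D (\<lambda>x. \<phi> x \<bullet> b) + D (\<lambda>x. - (\<phi> p \<bullet> b))"
      by (rule tangent_vector_add[OF D b_smooth smooth_at_const])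
    then show ?thesis by (simp add: coords[OF that] tangent_vector_const[OF D])
  qed
  have prod_smooth: "smooth_at p (\<lambda>x. ?x b x * g b (\<phi> x))" for b
    by (rule smooth_at_mult[OF x_smooth g_smooth])
  have "D (\<lambda>x. ?x b x * g b (\<phi> x)) = ?x b p * D (\<lambda>x. g b (\<phi> x)) + g b (\<phi> p) * D (?x b)" for b
    by (rule tangent_vector_mult[OF D x_smooth g_smooth])
  then have D_prod: "D (\<lambda>x. ?x b x * g b (\<phi> x)) = 0" if "b \<in> Basis" for b
    using D_x[OF that] by simp
  note sum = tangent_vector_sum[where f = "\<lambda>b x. ?x b x * g b (\<phi> x)" and I = Basis,
      OF D prod_smooth finite_Basis]
  have "D f = D (\<lambda>x. ?c x + (\<Sum>b\<in>Basis. ?x b x * g b (\<phi> x)))"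
  proof (rule tangent_vector_local[OF D _ _ _ True])
    let ?W = "{x \<in> U. \<phi> x \<in> ?T}"
    have "\<phi> ` ?W = ?T" using T(2) by auto
    then show "open ?W" using atlas_homeo[OF U(1), of ?W] T(1) by auto
    show "p \<in> ?W" using U(2) T(3) by simp
    fix x assume "x \<in> ?W"
    then show "f x = ?c x + (\<Sum>b\<in>Basis. ?x b x * g b (\<phi> x))"
      using g(2)[of "\<phi> x"] atlas_inj[OF U(1)] U(2) by (simp add: inner_diff_left)
  qed
  also have "\<dots> = D ?c + D (\<lambda>x. \<Sum>b\<in>Basis. ?x b x * g b (\<phi> x))"
    by (rule tangent_vector_add[OF D smooth_at_const conjunct1[OF sum]])
  also have "\<dots> = 0"
    using sum D_prod by (simp add: tangent_vector_const[OF D])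
  finally show ?thesis .
qed

lemma act_tangent_vector: "tangent_vector p (\<lambda>f. act X f p)"
  and act_translate: "act X f (a + p) = act X (\<lambda>x. f (a + x)) p"
  and act_smooth_fun_on: "open W \<Longrightarrow> smooth_fun_on W f \<Longrightarrow> smooth_fun_on W (act X f)"
  using act[of X] by (auto simp: smooth_vector_field_def left_invariant_def)

lemma lie_algebra_eq_0I:
  fixes X :: "'g::lie_group6 lie_algebra"
  assumes "\<And>f. act X f 0 = 0"
  shows "X = 0"
proof -
  have "act X f p = 0" for f p
    using act_translate[of X f p 0] assms by simp
  then have "act X = (\<lambda>f p. 0)" by (intro ext)
  then show ?thesis by (metis act_inverse zero_lie_algebra_def)
qed

text \<open>
  A left-invariant vector field is determined by its value at the identity, and a tangent vector at the
  identity by its effect on the six coordinates of a chart.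
\<close>

lemma lie_algebra_coordinates:
  obtains L :: "'g::lie_group6 lie_algebra \<Rightarrow> real ^ 6" where "linear L" "inj L"
proof -
  obtain U and \<phi> :: "'g \<Rightarrow> real ^ 6" where U: "(U, \<phi>) \<in> atlas" "0 \<in> U"
    using atlas_cover by blast
  define L where "L X = (\<Sum>b\<in>Basis. act X (\<lambda>x. \<phi> x \<bullet> b) 0 *\<^sub>R b)" for X :: "'g lie_algebra"
  have lin: "linear L"
    by (rule linearI) (simp_all add: L_def plus_lie_algebra.rep_eq scaleR_lie_algebra.rep_eq
        scaleR_add_left sum.distrib scaleR_sum_right)
  have "X = 0" if "L X = 0" for X
  proof (rule lie_algebra_eq_0I)
    have "act X (\<lambda>x. \<phi> x \<bullet> b) 0 = L X \<bullet> b" if "b \<in> Basis" for b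
      using that by (simp add: L_def inner_sum_left inner_Basis if_distrib cong: if_cong)
    then show "act X f 0 = 0" for f
      using tangent_vector_eq_0I[OF act_tangent_vector U] \<open>L X = 0\<close> by simp
  qed
  then have "inj L" using linear_injective_0[OF lin] by blast
  with lin show ?thesis by (rule that)
qed

lemma lie_algebra_independent_card:
  fixes B :: "'g::lie_group6 lie_algebra set"
  assumes "independent B"
  shows "finite B \<and> card B \<le> 6"
proof -
  obtain L :: "'g lie_algebra \<Rightarrow> real ^ 6" where L: "linear L" "inj L"
    using lie_algebra_coordinates .
  have inj: "inj_on L A" for A using L(2) by (rule inj_on_subset) simp
  have "independent (L ` B)"
    by (rule linear_independent_injective_image[OF L(1) assms inj])
  then have "finite (L ` B) \<and> card (L ` B) \<le> 6"
    using independent_bound[of "L ` B"] by simp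
  then show ?thesis
    using finite_imageD[OF _ inj] card_image[OF inj] by metis
qed

lemma bilinear_lie_bracket: "bilinear (lie_bracket :: 'g::lie_group6 lie_algebra \<Rightarrow> _)"
proof -
  have sm: "smooth_at p (act X f)" if "smooth_at p f" for X :: "'g lie_algebra" and p f
    using that act_smooth_fun_on unfolding smooth_at_def by blast
  have add: "act X (\<lambda>x. f x + g x) p = act X f p + act X g p"
    if "smooth_at p f" "smooth_at p g" for X :: "'g lie_algebra" and p f g
    using act_tangent_vector[of p X] that unfolding tangent_vector_def by blast
  have scale: "act X (\<lambda>x. c * f x) p = c * act X f p" if "smooth_at p f"
    for X :: "'g lie_algebra" and p c f
    using act_tangent_vector[of p X] that unfolding tangent_vector_def by blast
  note act_simps = lie_bracket.rep_eq plus_lie_algebra.rep_eq scaleR_lie_algebra.rep_eq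
    act_inject[symmetric] fun_eq_iff
  show ?thesis
    unfolding bilinear_def
    by (auto intro!: linearI simp: act_simps add[OF sm sm] scale[OF sm] algebra_simps)
qed

lemma lie_bracket_self: "lie_bracket X X = (0 :: 'g::lie_group6 lie_algebra)"
  by (simp add: act_inject[symmetric] fun_eq_iff lie_bracket.rep_eq zero_lie_algebra.rep_eq)

section \<open>Types, wedge products and exterior derivatives in coordinates\<close>

lemma sum_Pow_insert:
  assumes "finite A" "a \<notin> A"
  shows "(\<Sum>T\<in>Pow (insert a A). f T) = (\<Sum>T\<in>Pow A. f T) + (\<Sum>T\<in>Pow A. f (insert a T))"
proof -
  have "inj_on (insert a) (Pow A)"
    using assms(2) by (auto simp: inj_on_def)
  moreover have "Pow A \<inter> insert a ` Pow A = {}"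
    using assms(2) by auto
  ultimately show ?thesis
    using assms(1) by (simp add: Pow_insert sum.union_disjoint sum.reindex)
qed

lemma sum_subsets_card:
  assumes "finite A"
  shows "(\<Sum>S | S \<subseteq> A \<and> card S = k. f S) = (\<Sum>S\<in>Pow A. if card S = k then f S else 0)"
proof -
  have "{S. S \<subseteq> A \<and> card S = k} = {S \<in> Pow A. card S = k}" by auto
  then show ?thesis using assms by (simp only: sum.inter_filter finite_Pow_iff)
qed

lemmas type_part_expand = type_part_def sum_subsets_card sum_Pow_insert numeral_eq_Suc lessThan_Suc

lemma type_part_1_1:
  "type_part J 1 1 \<alpha> [x, y] = (\<alpha> [x, y] + \<alpha> [J x, J y]) / 2"
  by (simp add: type_part_expand)

lemma type_part_3_0:
  "type_part J 3 0 \<alpha> [x, y, z] =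
    (\<alpha> [x, y, z] - \<i> * \<alpha> [J x, y, z] - \<i> * \<alpha> [x, J y, z] - \<alpha> [J x, J y, z]
     - \<i> * \<alpha> [x, y, J z] - \<alpha> [J x, y, J z] - \<alpha> [x, J y, J z] + \<i> * \<alpha> [J x, J y, J z]) / 8"
  by (simp add: type_part_expand)

text \<open>
  The first two arguments span a complex line, and \<open>\<alpha>\<close> is complex linear in the other two.  Hence among the
  four ways to choose three slots of type \<open>(1, 0)\<close> only the two that contain the last two slots
  contribute; each gives half of \<open>\<alpha>\<close>.
\<close>

lemma type_part_3_1:
  fixes J :: "'v::real_vector \<Rightarrow> 'v"
  assumes J: "\<And>x. J (J x) = - x"
    and zero: "\<And>x y. \<alpha> [v, - v, x, y] = 0" "\<And>x y. \<alpha> [J v, J v, x, y] = 0"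
    and rot: "\<And>x y. \<alpha> [J v, - v, x, y] = \<alpha> [v, J v, x, y]"
    and lin: "\<alpha> [v, J v, J x, y] = \<i> * \<alpha> [v, J v, x, y]"
      "\<alpha> [v, J v, J x, J y] = \<i> * \<alpha> [v, J v, x, J y]"
      "\<alpha> [v, J v, x, J y] = \<i> * \<alpha> [v, J v, x, y]"
  shows "type_part J 3 1 \<alpha> [v, J v, x, y] = \<alpha> [v, J v, x, y]"
  by (simp add: type_part_expand J zero rot lin)

lemma sign_sign_mult: "of_int (sign q) * (of_int (sign q) * x) = (x :: real)"
  by (simp add: sign_def)

text \<open>
  Permutations of \<open>insert a S\<close> are sorted by the image \<open>b\<close> of \<open>a\<close>.  Iterated, this makes signed sums over
  small permutation groups explicit.
\<close>

lemma sum_sign_permutes_insert: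
  fixes h :: "(nat \<Rightarrow> nat) \<Rightarrow> real"
  assumes "finite S" "a \<notin> S"
  shows "(\<Sum>\<sigma> | \<sigma> permutes insert a S. of_int (sign \<sigma>) * h \<sigma>) =
    (\<Sum>b\<in>insert a S. (if b = a then 1 else - 1) *
      (\<Sum>\<sigma> | \<sigma> permutes S. of_int (sign \<sigma>) * h (Transposition.transpose a b \<circ> \<sigma>)))"
proof -
  have "sign (Transposition.transpose a b \<circ> \<sigma>) = (if b = a then 1 else - 1) * sign \<sigma>" if "\<sigma> permutes S" for b \<sigma>
  proof -
    have "permutation \<sigma>" using that assms(1) by (auto simp: permutation_permutes)
    then show ?thesis by (simp add: sign_compose permutation_swap_id sign_swap_id)
  qed
  then have "of_int (sign (Transposition.transpose a b \<circ> \<sigma>)) * h (Transposition.transpose a b \<circ> \<sigma>)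
      = (if b = a then 1 else - 1) * (of_int (sign \<sigma>) * h (Transposition.transpose a b \<circ> \<sigma>))"
    if "\<sigma> permutes S" for b \<sigma>
    using that by simp
  then show ?thesis
    unfolding sum_over_permutations_insert[OF assms] sum_distrib_left
    by (intro sum.cong) auto
qed

text \<open>
  The substitution of \<open>q \<circ> \<sigma>\<close> for \<open>\<sigma>\<close> in the sum over all permutations.
\<close>

lemma wedge_permute:
  assumes q: "q permutes {..<p + r}"
  shows "wedge p r \<alpha> \<beta> (map (\<lambda>i. xs ! q i) [0..<p + r]) = of_int (sign q) * wedge p r \<alpha> \<beta> xs"
proof -
  let ?P = "{\<sigma>. \<sigma> permutes {..<p + r}}"
  let ?h = "\<lambda>\<sigma>. \<alpha> (map (\<lambda>i. xs ! \<sigma> i) [0..<p]) * \<beta> (map (\<lambda>i. xs ! \<sigma> i) [p..<p + r])"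
  have perm: "permutation \<sigma>" if "\<sigma> permutes {..<p + r}" for \<sigma>
    using that by (auto simp: permutation_permutes)
  have sgn: "of_int (sign q) * (of_int (sign (q \<circ> \<sigma>)) * ?h (q \<circ> \<sigma>))
      = of_int (sign \<sigma>) * ?h (q \<circ> \<sigma>)" if "\<sigma> permutes {..<p + r}" for \<sigma>
    by (simp only: sign_compose[OF perm[OF q] perm[OF that]] of_int_mult mult.assoc sign_sign_mult)
  have h: "?h (q \<circ> \<sigma>) = \<alpha> (map (\<lambda>i. map (\<lambda>i. xs ! q i) [0..<p + r] ! \<sigma> i) [0..<p]) *
      \<beta> (map (\<lambda>i. map (\<lambda>i. xs ! q i) [0..<p + r] ! \<sigma> i) [p..<p + r])"
    if "\<sigma> permutes {..<p + r}" for \<sigma>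
  proof -
    have "\<sigma> i < p + r" if "i < p + r" for i
      using permutes_in_image[OF \<open>\<sigma> permutes _\<close>, of i] that by simp
    then have "map (\<lambda>i. xs ! (q \<circ> \<sigma>) i) [0..<p]
        = map (\<lambda>i. map (\<lambda>i. xs ! q i) [0..<p + r] ! \<sigma> i) [0..<p]"
      "map (\<lambda>i. xs ! (q \<circ> \<sigma>) i) [p..<p + r]
        = map (\<lambda>i. map (\<lambda>i. xs ! q i) [0..<p + r] ! \<sigma> i) [p..<p + r]"
      by (auto intro!: map_cong)
    then show ?thesis by (simp only:)
  qed
  have "of_int (sign q) * (\<Sum>\<sigma>\<in>?P. of_int (sign \<sigma>) * ?h \<sigma>)
      = (\<Sum>\<sigma>\<in>?P. of_int (sign q) * (of_int (sign (q \<circ> \<sigma>)) * ?h (q \<circ> \<sigma>)))"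
    by (subst setum_permutations_compose_left[OF q]) (simp add: sum_distrib_left)
  also have "\<dots> = (\<Sum>\<sigma>\<in>?P. of_int (sign \<sigma>) * ?h (q \<circ> \<sigma>))"
    by (rule sum.cong) (auto simp only: mem_Collect_eq sgn)
  also have "\<dots> = (\<Sum>\<sigma>\<in>?P. of_int (sign \<sigma>) *
      (\<alpha> (map (\<lambda>i. map (\<lambda>i. xs ! q i) [0..<p + r] ! \<sigma> i) [0..<p]) *
       \<beta> (map (\<lambda>i. map (\<lambda>i. xs ! q i) [0..<p + r] ! \<sigma> i) [p..<p + r])))"
    by (rule sum.cong) (simp_all only: mem_Collect_eq h)
  finally show ?thesis
    unfolding wedge_def by (simp only: mult.assoc times_divide_eq_right)
qed

lemma wedge_2_2:
  fixes \<omega> :: "'v \<Rightarrow> 'v \<Rightarrow> real"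
  assumes alt: "\<And>x y. \<omega> y x = - \<omega> x y"
  shows "wedge 2 2 (two_form \<omega>) (two_form \<omega>) [x0, x1, x2, x3] =
    2 * (\<omega> x0 x1 * \<omega> x2 x3 - \<omega> x0 x2 * \<omega> x1 x3 + \<omega> x0 x3 * \<omega> x1 x2)"
proof -
  note flip = alt[of x1 x0] alt[of x2 x0] alt[of x3 x0] alt[of x2 x1] alt[of x3 x1] alt[of x3 x2]
  have upt: "[0..<2] = [0, 1]" "[2..<4] = [2, 3::nat]" by (simp_all add: upt_rec numeral_eq_Suc)
  have four: "{..<2 + 2} = insert 3 (insert 2 (insert 1 (insert (0::nat) {})))" by auto
  show ?thesis
    unfolding wedge_def four mult.assoc
    by (simp add: sum_sign_permutes_insert upt Transposition.transpose_def flip del: One_nat_def)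
qed

text \<open>
  The two outer transpositions choose the arguments of \<open>\<beta>\<close>.  The 24 permutations of the remaining
  arguments all contribute the same because \<open>\<alpha>\<close> is alternating, so the 720 terms of the definition
  reduce to 30.
\<close>

lemma wedge_4_2:
  assumes \<alpha>: "\<And>xs q. q permutes {..<4} \<Longrightarrow>
      \<alpha> (map (\<lambda>i. xs ! q i) [0..<4]) = of_int (sign q) * \<alpha> xs"
  shows "wedge 4 2 \<alpha> \<beta> xs = (\<Sum>b\<in>{..<6}. \<Sum>c\<in>{..<5}.
    (if b = 5 then 1 else - 1) * ((if c = 4 then 1 else - 1) *
     (\<alpha> (map (\<lambda>i. xs ! Transposition.transpose 5 b (Transposition.transpose 4 c i)) [0..<4]) *
      \<beta> (map (\<lambda>i. xs ! Transposition.transpose 5 b (Transposition.transpose 4 c i)) [4..<6])))) / 2"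
proof -
  have inner: "(\<Sum>q | q permutes {..<4}. of_int (sign q) *
      (\<alpha> (map (\<lambda>i. xs ! t (q i)) [0..<4]) * \<beta> (map (\<lambda>i. xs ! t (q i)) [4..<6])))
    = 24 * (\<alpha> (map (\<lambda>i. xs ! t i) [0..<4]) * \<beta> (map (\<lambda>i. xs ! t i) [4..<6]))" for t
  proof -
    have "of_int (sign q) * (\<alpha> (map (\<lambda>i. xs ! t (q i)) [0..<4]) * \<beta> (map (\<lambda>i. xs ! t (q i)) [4..<6]))
        = \<alpha> (map (\<lambda>i. xs ! t i) [0..<4]) * \<beta> (map (\<lambda>i. xs ! t i) [4..<6])"
      if q: "q permutes {..<4}" for q
    proof -
      have "map (\<lambda>i. xs ! t (q i)) [0..<4] = map (\<lambda>i. map (\<lambda>i. xs ! t i) [0..<4] ! q i) [0..<4]"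
        using permutes_in_image[OF q] by (auto intro!: map_cong)
      moreover have "map (\<lambda>i. xs ! t (q i)) [4..<6] = map (\<lambda>i. xs ! t i) [4..<6]"
        using q by (auto simp: permutes_not_in intro!: map_cong)
      ultimately show ?thesis
        by (simp only: \<alpha>[OF q] mult.assoc sign_sign_mult)
    qed
    then have "(\<Sum>q | q permutes {..<4}. of_int (sign q) *
        (\<alpha> (map (\<lambda>i. xs ! t (q i)) [0..<4]) * \<beta> (map (\<lambda>i. xs ! t (q i)) [4..<6])))
      = (\<Sum>q | q permutes {..<4::nat}.
          \<alpha> (map (\<lambda>i. xs ! t i) [0..<4]) * \<beta> (map (\<lambda>i. xs ! t i) [4..<6]))"
      by (intro sum.cong) auto
    also have "card {q. q permutes {..<4::nat}} = 24"
      by (subst card_permutations[of _ 4]) (auto simp: fact_numeral)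
    ultimately show ?thesis by simp
  qed
  let ?h = "\<lambda>\<sigma>. \<alpha> (map (\<lambda>i. xs ! \<sigma> i) [0..<4]) * \<beta> (map (\<lambda>i. xs ! \<sigma> i) [4..<6])"
  have inner': "(\<Sum>\<sigma> | \<sigma> permutes {..<4}.
        of_int (sign \<sigma>) * ?h (Transposition.transpose 5 b \<circ> (Transposition.transpose 4 c \<circ> \<sigma>)))
      = 24 * ?h (\<lambda>i. Transposition.transpose 5 b (Transposition.transpose 4 c i))" for b c
    using inner[of "\<lambda>i. Transposition.transpose 5 b (Transposition.transpose 4 c i)"]
    by (simp only: o_apply)
  have six: "{..<6} = insert 5 {..<5::nat}" and five: "{..<5} = insert 4 {..<4::nat}"
    by auto
  have "(\<Sum>\<sigma> | \<sigma> permutes {..<6}. of_int (sign \<sigma>) * ?h \<sigma>) =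
      (\<Sum>b\<in>{..<6}. (if b = 5 then 1 else - 1) * (\<Sum>\<sigma> | \<sigma> permutes {..<5}.
        of_int (sign \<sigma>) * ?h (Transposition.transpose 5 b \<circ> \<sigma>)))"
    unfolding six by (rule sum_sign_permutes_insert) auto
  also have "\<dots> = (\<Sum>b\<in>{..<6}. (if b = 5 then 1 else - 1) * (\<Sum>c\<in>{..<5}.
      (if c = 4 then 1 else - 1) * (\<Sum>\<sigma> | \<sigma> permutes {..<4}.
        of_int (sign \<sigma>) * ?h (Transposition.transpose 5 b \<circ> (Transposition.transpose 4 c \<circ> \<sigma>)))))"
    unfolding five
    by (subst sum_sign_permutes_insert[where h = "\<lambda>\<sigma>. ?h (Transposition.transpose 5 b \<circ> \<sigma>)" for b])
       auto
  also have "\<dots> = 24 * (\<Sum>b\<in>{..<6}. \<Sum>c\<in>{..<5}.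
    (if b = 5 then 1 else - 1) * ((if c = 4 then 1 else - 1) *
      ?h (\<lambda>i. Transposition.transpose 5 b (Transposition.transpose 4 c i))))"
    unfolding inner' sum_distrib_left
    by (intro sum.cong refl) (simp only: mult.left_commute)
  finally show ?thesis
    unfolding wedge_def by (simp add: fact_numeral mult.assoc)
qed

text \<open>
  \<open>\<omega>\<^sup>2\<close> vanishes on four vectors of a unitary frame unless they form two of its three complex lines.  Up to
  the factor, wedging a 2-form with \<open>\<omega>\<^sup>2\<close> is therefore its trace against \<open>\<omega>\<close>.
\<close>

lemma wedge_unitary_frame:
  fixes \<omega> :: "'v \<Rightarrow> 'v \<Rightarrow> real"
  assumes alt: "\<And>x y. \<omega> y x = - \<omega> x y" and \<beta>: "\<And>x y. \<beta> [y, x] = - \<beta> [x, y]"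
    and frame: "\<omega> x x' = 1" "\<omega> y y' = 1" "\<omega> z z' = 1"
      "\<omega> x y = 0" "\<omega> x y' = 0" "\<omega> x z = 0" "\<omega> x z' = 0"
      "\<omega> x' y = 0" "\<omega> x' y' = 0" "\<omega> x' z = 0" "\<omega> x' z' = 0"
      "\<omega> y z = 0" "\<omega> y z' = 0" "\<omega> y' z = 0" "\<omega> y' z' = 0"
  shows "wedge 4 2 (wedge 2 2 (two_form \<omega>) (two_form \<omega>)) \<beta> [x, x', y, y', z, z'] =
    2 * (\<beta> [x, x'] + \<beta> [y, y'] + \<beta> [z, z'])"
proof -
  define \<omega>\<omega> where "\<omega>\<omega> = wedge 2 2 (two_form \<omega>) (two_form \<omega>)"
  have perm: "\<omega>\<omega> (map (\<lambda>i. xs ! q i) [0..<4]) = of_int (sign q) * \<omega>\<omega> xs"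
    if "q permutes {..<4}" for q xs
    using wedge_permute[of q 2 2] that by (simp add: \<omega>\<omega>_def)
  have \<omega>\<omega>: "\<omega>\<omega> [p, q, r, s] = 2 * (\<omega> p q * \<omega> r s - \<omega> p r * \<omega> q s + \<omega> p s * \<omega> q r)" for p q r s
    unfolding \<omega>\<omega>_def by (rule wedge_2_2) (rule alt)
  have zero: "\<omega> p p = 0" for p using alt[of p p] by simp
  have upt: "[0..<4] = [0, 1, 2, 3::nat]" "[4..<6] = [4, 5::nat]"
    by (simp_all add: upt_rec numeral_eq_Suc)
  have six: "{..<6} = {0, 1, 2, 3, 4, 5::nat}" and five: "{..<5} = {0, 1, 2, 3, 4::nat}"
    by auto
  note flip = alt[of x' x] alt[of y' y] alt[of z' z] alt[of y x] alt[of y' x] alt[of z x]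
    alt[of z' x] alt[of y x'] alt[of y' x'] alt[of z x'] alt[of z' x'] alt[of z y] alt[of z' y]
    alt[of z y'] alt[of z' y'] \<beta>[of x' x] \<beta>[of y' y] \<beta>[of z' z]
  have "wedge 4 2 \<omega>\<omega> \<beta> [x, x', y, y', z, z'] = 2 * (\<beta> [x, x'] + \<beta> [y, y'] + \<beta> [z, z'])"
    apply (subst wedge_4_2, erule perm)
    unfolding six five upt
    apply (simp add: Transposition.transpose_def)
    apply (simp only: \<omega>\<omega>)
    apply (simp only: frame flip zero minus_zero minus_minus mult_zero_left mult_zero_right
        mult_1_left mult_1_right diff_0 diff_0_right add_0_left add_0_right)
    done
  then show ?thesis by (simp only: \<omega>\<omega>_def)
qed

lemma sum_pairs_less_Suc:
  fixes f :: "nat \<times> nat \<Rightarrow> 'a::comm_monoid_add"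
  shows "(\<Sum>p\<in>{(i, j). i < j \<and> j < Suc n}. f p) =
    (\<Sum>p\<in>{(i, j). i < j \<and> j < n}. f p) + (\<Sum>i<n. f (i, n))"
proof -
  have fin: "finite {(i, j). i < j \<and> j < n}"
    by (rule finite_subset[of _ "{..<n} \<times> {..<n}"]) auto
  have "{(i, j). i < j \<and> j < Suc n} = {(i, j). i < j \<and> j < n} \<union> (\<lambda>i. (i, n)) ` {..<n}"
    by auto
  moreover have "{(i, j). i < j \<and> j < n} \<inter> (\<lambda>i. (i, n)) ` {..<n} = {}"
    by auto
  ultimately show ?thesis
    using fin by (simp only: sum.union_disjoint finite_imageI finite_lessThan)
      (simp add: sum.reindex inj_on_def)
qed

lemma no_pairs_less_0: "{(i, j). i < j \<and> j = (0::nat)} = {}"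
  by auto

lemma ext_deriv_3:
  "ext_deriv \<alpha> [x0, x1, x2] = - \<alpha> [lie_bracket x0 x1, x2] + \<alpha> [lie_bracket x0 x2, x1]
    - \<alpha> [lie_bracket x1 x2, x0]"
  by (simp add: ext_deriv_def sum_pairs_less_Suc no_pairs_less_0 lessThan_Suc nths_Cons)

lemma ext_deriv_4:
  "ext_deriv \<alpha> [x0, x1, x2, x3] = - \<alpha> [lie_bracket x0 x1, x2, x3] + \<alpha> [lie_bracket x0 x2, x1, x3]
    - \<alpha> [lie_bracket x0 x3, x1, x2] - \<alpha> [lie_bracket x1 x2, x0, x3]
    + \<alpha> [lie_bracket x1 x3, x0, x2] - \<alpha> [lie_bracket x2 x3, x0, x1]"
  by (simp add: ext_deriv_def sum_pairs_less_Suc no_pairs_less_0 lessThan_Suc nths_Cons)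

lemma ext_deriv_5:
  "ext_deriv \<alpha> [x0, x1, x2, x3, x4] =
    - \<alpha> [lie_bracket x0 x1, x2, x3, x4] + \<alpha> [lie_bracket x0 x2, x1, x3, x4]
    - \<alpha> [lie_bracket x0 x3, x1, x2, x4] + \<alpha> [lie_bracket x0 x4, x1, x2, x3]
    - \<alpha> [lie_bracket x1 x2, x0, x3, x4] + \<alpha> [lie_bracket x1 x3, x0, x2, x4]
    - \<alpha> [lie_bracket x1 x4, x0, x2, x3] - \<alpha> [lie_bracket x2 x3, x0, x1, x4]
    + \<alpha> [lie_bracket x2 x4, x0, x1, x3] - \<alpha> [lie_bracket x3 x4, x0, x1, x2]"
  by (simp add: ext_deriv_def sum_pairs_less_Suc no_pairs_less_0 lessThan_Suc nths_Cons)

section \<open>Hermitian vector spaces and their connections\<close>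

lemma eq_uminus_self_iff: "x = - x \<longleftrightarrow> x = (0::'v::real_vector)"
proof
  assume "x = - x"
  then have "2 *\<^sub>R x = 0" by (simp add: scaleR_2 eq_neg_iff_add_eq_0)
  then show "x = 0" by simp
qed simp

text \<open>
  The linear algebra of a Hermitian structure, apart from the Lie bracket and in any dimension.
\<close>

locale hermitian_space =
  fixes \<omega> :: "'v::real_vector \<Rightarrow> 'v \<Rightarrow> real" and J :: "'v \<Rightarrow> 'v"
  assumes bilinear_omega: "bilinear \<omega>"
    and omega_self: "\<omega> x x = 0"
    and omega_J_J: "\<omega> (J x) (J y) = \<omega> x y"
    and linear_J: "linear J"
    and J_J [simp]: "J (J x) = - x"
    and metric_pos: "x \<noteq> 0 \<Longrightarrow> metric \<omega> J x x > 0"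
begin

abbreviation g :: "'v \<Rightarrow> 'v \<Rightarrow> real" where "g \<equiv> metric \<omega> J"

lemmas J_linear [simp] = linear_add[OF linear_J] linear_diff[OF linear_J] linear_neg[OF linear_J]
  linear_0[OF linear_J] linear_cmul[OF linear_J]

lemma omega_skew: "\<omega> y x = - \<omega> x y"
proof -
  have "\<omega> (x + y) (x + y) = 0" by (rule omega_self)
  then show ?thesis
    using omega_self[of x] omega_self[of y]
    by (simp add: bilinear_ladd[OF bilinear_omega] bilinear_radd[OF bilinear_omega])
qed

lemma omega_eq_metric: "\<omega> x y = g (J x) y"
  by (simp add: metric_def omega_J_J)

lemma metric_bilinear [simp]:
  "g (x + y) z = g x z + g y z" "g x (y + z) = g x y + g x z"
  "g (x - y) z = g x z - g y z" "g x (y - z) = g x y - g x z"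
  "g (- x) z = - g x z" "g x (- z) = - g x z"
  "g 0 z = 0" "g x 0 = 0"
  "g (c *\<^sub>R x) z = c * g x z" "g x (c *\<^sub>R z) = c * g x z"
  using bilinear_omega
  by (simp_all add: metric_def bilinear_ladd bilinear_radd bilinear_lsub bilinear_rsub bilinear_lneg
      bilinear_rneg bilinear_lzero bilinear_rzero bilinear_lmul bilinear_rmul)

lemma metric_sym: "g x y = g y x"
proof -
  have "\<omega> x (J y) = \<omega> (J x) (- y)" using omega_J_J[of x "J y"] by simp
  also have "\<dots> = \<omega> y (J x)"
    using omega_skew[where y = y and x = "J x"] bilinear_rneg[OF bilinear_omega, of "J x" y] by simp
  finally show ?thesis by (simp add: metric_def)
qed

lemma metric_J_J [simp]: "g (J x) (J y) = g x y"
  using omega_J_J[of x "J y"] by (simp add: metric_def)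

lemma metric_J_left: "g (J x) y = - g x (J y)"
  using metric_J_J[of x "J y"] by simp

lemma metric_J_self [simp]: "g x (J x) = 0" "g (J x) x = 0"
  using metric_J_left[of x x] metric_sym[of "J x" x] by simp_all

lemma metric_self_eq_0 [simp]: "g x x = 0 \<longleftrightarrow> x = 0"
  using metric_pos[of x] by (cases "x = 0") auto

lemma metric_nonneg: "g x x \<ge> 0"
  using metric_pos[of x] by (cases "x = 0") auto

lemma metric_eqI: "(\<And>z. g x z = g y z) \<Longrightarrow> x = y"
  using metric_self_eq_0[of "x - y"] by simp

lemma J_eq_0 [simp]: "J x = 0 \<longleftrightarrow> x = 0"
  by (metis J_J J_linear(4) neg_equal_0_iff_equal)

lemma hermitian_connection_simps:
  assumes "hermitian_connection \<omega> J D"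
  shows "D (x + x') y = D x y + D x' y" "D x (y + y') = D x y + D x y'"
    "D (c *\<^sub>R x) y = c *\<^sub>R D x y" "D x (c *\<^sub>R y) = c *\<^sub>R D x y"
    "D x (- y) = - D x y" "D (- x) y = - D x y"
    "D x (J y) = J (D x y)" "g (D x y) z = - g y (D x z)"
  using assms unfolding hermitian_connection_def
  by (simp_all add: bilinear_ladd bilinear_radd bilinear_lmul bilinear_rmul
      bilinear_lneg bilinear_rneg eq_neg_iff_add_eq_0)

text \<open>
  Let \<open>E\<close> be the difference of the two connections.  By the torsion condition the map
  \<open>F x y = E x y + J (E (J x) y)\<close> is symmetric.  It is complex linear in \<open>y\<close> and antilinear in \<open>x\<close>, so it vanishes,
  which means that \<open>E\<close> is complex linear in its direction \<open>x\<close>.  But then both \<open>E x\<close> and \<open>J \<circ> E x = E (J x)\<close> are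
  skew, and a skew endomorphism that commutes with \<open>J\<close> stays skew after multiplication with \<open>J\<close> only
  if it is zero.
\<close>

lemma chern_unique:
  assumes D: "hermitian_connection \<omega> J D" "hermitian_connection \<omega> J D'"
    and torsion: "\<And>x y. D x y - D y x + D (J x) (J y) - D (J y) (J x) =
      D' x y - D' y x + D' (J x) (J y) - D' (J y) (J x)"
  shows "D = D'"
proof (intro ext metric_eqI)
  note D = hermitian_connection_simps[OF D(1)] hermitian_connection_simps[OF D(2)]
  define E where "E x y = D x y - D' x y" for x y
  have E_J: "E x (J y) = J (E x y)" and E_skew: "g (E x y) z = - g y (E x z)"
    and E_neg: "E (- x) y = - E x y" for x y z
    by (simp_all add: E_def D(7,15) D(6,14) D(8)[of x y z] D(16)[of x y z])
  define F where "F x y = E x y + J (E (J x) y)" for x y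
  have F_sym: "F x y = F y x" for x y
    using torsion[of x y] by (simp add: F_def E_def D algebra_simps)
  have "F (J x) y = - J (F x y)" and F_J: "F x (J y) = J (F x y)" for x y
    by (simp_all add: F_def E_J E_neg)
  then have "J (F x y) = - J (F x y)" for x y
    by (metis F_sym)
  then have "F x y = 0" for x y
    by (simp only: eq_uminus_self_iff J_eq_0)
  then have "J (E x y + J (E (J x) y)) = 0" for x y
    by (simp add: F_def)
  then have E_J_left: "E (J x) y = J (E x y)" for x y
    by simp
  have *: "g (J (E x y)) z = 0" for x y z
  proof -
    have "g (J (E x y)) z = - g y (J (E x z))"
      using E_skew[of "J x" y z] by (simp add: E_J_left)
    also have "\<dots> = g (J y) (E x z)"
      by (simp add: metric_J_left)
    also have "\<dots> = - g (J (E x y)) z"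
      using E_skew[of x "J y" z] by (simp add: E_J)
    finally show ?thesis by simp
  qed
  fix x y z
  show "g (D x y) z = g (D' x y) z"
    using *[of x "J y" z] by (simp add: E_J) (simp add: E_def)
qed

text \<open>
  The hypothesis says that the two torsions agree when their second argument is repeated, as is the
  case if both are 3-forms; \<open>c x y\<close> stands for the contribution of the Lie bracket.  The difference of
  the two connections then is a totally skew trilinear form \<open>E\<close>.  It is invariant under \<open>J\<close> applied in any
  two slots, so moving one \<open>J\<close> from a slot to another changes the sign.  Moving it once around the
  three slots shows that \<open>E\<close> is its own negative as soon as one argument is of the form \<open>J z\<close>.
\<close>

lemma bismut_unique:
  assumes D: "hermitian_connection \<omega> J D" "hermitian_connection \<omega> J D'"
    and skew: "\<And>x y. g (D x y - D y x) y = c x y" "\<And>x y. g (D' x y - D' y x) y = c x y"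
  shows "D = D'"
proof (intro ext metric_eqI)
  note D = hermitian_connection_simps[OF D(1)] hermitian_connection_simps[OF D(2)]
  define E where "E x y z = g (D x y - D' x y) z" for x y z
  have E_skew: "E x y z = - E x z y" for x y z
    by (simp add: E_def D(8)[of x y z] D(16)[of x y z] metric_sym[of y])
  then have E_same: "E x y y = 0" for x y
    by (metis equal_neg_zero)
  have "E y x y = 0" for x y
    using skew[of x y] E_same[of x y] by (simp add: E_def)
  then have "E x x y = 0" for x y
    using E_skew[of x x y] by simp
  then have "E (x + y) (x + y) z = 0" "E x x z = 0" "E y y z = 0" for x y z
    by blast+
  moreover have "E (x + y) (x + y) z = E x x z + E x y z + E y x z + E y y z" for x y z
    by (simp add: E_def D)
  ultimately have E_skew': "E y x z = - E x y z" for x y z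
    by (metis add.left_neutral add.right_neutral add.commute eq_neg_iff_add_eq_0)
  have E_23: "E x (J y) z = - E x y (J z)" for x y z
    using metric_J_left by (simp add: E_def D(7,15))
  have E_12: "E (J x) y z = - E x (J y) z" for x y z
    using E_23[of z x y] E_skew E_skew' by metis
  have E_13: "E (J x) y z = - E x y (J z)" for x y z
    using E_23[of y x z] E_skew E_skew' by metis
  have E_J: "E x y (J z) = 0" for x y z
    using E_12[of x y z] E_23[of x y z] E_13[of x y z] by simp
  fix x y z
  show "g (D x y) z = g (D' x y) z"
    using E_J[of x y "J z"] by (simp add: E_def)
qed

lemma type_part_1_1_eq_0_iff:
  "(\<forall>w xs. length xs = 2 \<longrightarrow>
      type_part J 1 1 (two_form (\<lambda>x y. complex_of_real (g (T x y) w))) xs = 0) \<longleftrightarrow>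
    (\<forall>x y. T (J x) (J y) = - T x y)" (is "?l \<longleftrightarrow> ?r")
proof
  assume ?l
  show ?r
  proof (intro allI metric_eqI)
    fix x y w
    have "type_part J 1 1 (two_form (\<lambda>x y. complex_of_real (g (T x y) w))) [x, y] = 0"
      using \<open>?l\<close> by simp
    then have "complex_of_real (g (T x y) w + g (T (J x) (J y)) w) = 0"
      unfolding type_part_1_1 by simp
    then show "g (T (J x) (J y)) w = g (- T x y) w"
      unfolding of_real_eq_0_iff by simp
  qed
next
  assume ?r
  show ?l
  proof (intro allI impI)
    fix w and xs :: "'v list" assume "length xs = 2"
    then obtain x y where "xs = [x, y]"
      by (auto simp: numeral_2_eq_2 length_Suc_conv)
    then show "type_part J 1 1 (two_form (\<lambda>x y. complex_of_real (g (T x y) w))) xs = 0"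
      using \<open>?r\<close> by (simp only: type_part_1_1) simp
  qed
qed

end

section \<open>Volume forms and unitary frames\<close>

text \<open>
  Alternating forms of type \<open>(3, 0)\<close>, as functions of three vectors.
\<close>

locale volume_form =
  fixes J :: "'v::real_vector \<Rightarrow> 'v" and \<psi> :: "'v \<Rightarrow> 'v \<Rightarrow> 'v \<Rightarrow> complex"
  assumes add: "\<psi> (x + x') y z = \<psi> x y z + \<psi> x' y z"
    and scale: "\<psi> (c *\<^sub>R x) y z = of_real c * \<psi> x y z"
    and J_left: "\<psi> (J x) y z = \<i> * \<psi> x y z"
    and skew_12: "\<psi> y x z = - \<psi> x y z"
    and skew_23: "\<psi> x z y = - \<psi> x y z"
begin

lemma same [simp]: "\<psi> x x z = 0" "\<psi> x y y = 0" "\<psi> x y x = 0"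
  using skew_12[where x = x and y = x and z = z] skew_23[where x = x and y = y and z = y]
    skew_12[where x = x and y = y and z = x] skew_23[where x = y and y = x and z = x] by simp_all

lemma add_2: "\<psi> x (y + y') z = \<psi> x y z + \<psi> x y' z"
  and scale_2: "\<psi> x (c *\<^sub>R y) z = of_real c * \<psi> x y z"
  and J_2: "\<psi> x (J y) z = \<i> * \<psi> x y z"
  using skew_12[where y = x] by (simp_all add: add scale J_left)

lemma add_3: "\<psi> x y (z + z') = \<psi> x y z + \<psi> x y z'"
  and scale_3: "\<psi> x y (c *\<^sub>R z) = of_real c * \<psi> x y z"
  and J_3: "\<psi> x y (J z) = \<i> * \<psi> x y z"
  using skew_23[where z = y] by (simp_all add: add_2 scale_2 J_2)

lemma minus: "\<psi> (- x) y z = - \<psi> x y z" "\<psi> x (- y) z = - \<psi> x y z" "\<psi> x y (- z) = - \<psi> x y z"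
  using scale[of "-1"] scale_2[of _ "-1"] scale_3[of _ _ "-1"] by simp_all

lemma zero: "\<psi> 0 y z = 0"
  using scale[of 0 0] by simp

lemma expand_left:
  "\<psi> (a *\<^sub>R p + a' *\<^sub>R J p + b *\<^sub>R q + b' *\<^sub>R J q + c *\<^sub>R r + c' *\<^sub>R J r) y z =
    Complex a a' * \<psi> p y z + Complex b b' * \<psi> q y z + Complex c c' * \<psi> r y z"
  by (simp add: add scale J_left Complex_eq algebra_simps)

text \<open>
  Expanding all three arguments leaves the determinant of the coefficients times \<open>\<psi> p q r\<close>.  The
  vectors \<open>q\<close> and \<open>r\<close> may be zero, so this also says that \<open>\<psi>\<close> vanishes if the complex dimension is below
  three.
\<close>

lemma vanishing:
  assumes span: "\<And>x. \<exists>a a' b b' c c'.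
      x = a *\<^sub>R p + a' *\<^sub>R J p + b *\<^sub>R q + b' *\<^sub>R J q + c *\<^sub>R r + c' *\<^sub>R J r"
    and zero: "\<psi> p q r = 0"
  shows "\<psi> x y z = 0"
proof -
  have coeffs: "\<exists>a b c. \<forall>y z. \<psi> x y z = a * \<psi> p y z + b * \<psi> q y z + c * \<psi> r y z" for x
    using span[of x] expand_left by metis
  have perms: "\<psi> p r q = 0" "\<psi> q p r = 0" "\<psi> q r p = 0" "\<psi> r p q = 0" "\<psi> r q p = 0"
    using zero skew_12 skew_23 by (metis add.inverse_neutral)+
  have 2: "\<psi> b b' z = 0" if "b \<in> {p, q, r}" "b' \<in> {p, q, r}" for b b' z
  proof -
    obtain c1 c2 c3 where "\<And>y y'. \<psi> z y y' = c1 * \<psi> p y y' + c2 * \<psi> q y y' + c3 * \<psi> r y y'"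
      using coeffs[of z] by blast
    then have "\<psi> z b b' = 0" using that zero perms by auto
    then show ?thesis using skew_12 skew_23 by (metis add.inverse_neutral)
  qed
  have 1: "\<psi> b y z = 0" if b: "b \<in> {p, q, r}" for b y z
  proof -
    obtain c1 c2 c3 where "\<And>x x'. \<psi> y x x' = c1 * \<psi> p x x' + c2 * \<psi> q x x' + c3 * \<psi> r x x'"
      using coeffs[of y] by blast
    then have "\<psi> y b z = 0" using 2 b by simp
    then show ?thesis using skew_12 by (metis add.inverse_neutral)
  qed
  show ?thesis using coeffs[of x] 1 by force
qed

end

text \<open>
  Complex linearity holds because replacing \<open>x\<close> by \<open>J x\<close> multiplies the formula for the \<open>(3, 0)\<close>-part by \<open>\<i>\<close>.
\<close>

lemma volume_form_of_type_3_0: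
  fixes J :: "'v::real_vector \<Rightarrow> 'v"
  assumes J: "\<And>x. J (J x) = - x" and alt: "alternating_form 3 \<Psi>"
    and type: "\<And>xs. length xs = 3 \<Longrightarrow> type_part J 3 0 \<Psi> xs = \<Psi> xs"
  shows "volume_form J (\<lambda>x y z. \<Psi> [x, y, z])"
proof -
  have lin: "linear (\<lambda>x. \<Psi> [x, y, z])" "linear (\<lambda>x. \<Psi> [y, x, z])" "linear (\<lambda>x. \<Psi> [y, z, x])" for y z
  proof -
    have "linear (\<lambda>x. \<Psi> (xs[i := x]))" if "length xs = 3" "i < 3" for xs i
      using alt that unfolding alternating_form_def by blast
    from this[of "[y, y, z]" 0] this[of "[y, y, z]" 1] this[of "[y, z, z]" 2]
    show "linear (\<lambda>x. \<Psi> [x, y, z])" "linear (\<lambda>x. \<Psi> [y, x, z])" "linear (\<lambda>x. \<Psi> [y, z, x])"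
      by simp_all
  qed
  note lin_simps = linear_add[OF lin(1)] linear_add[OF lin(2)] linear_add[OF lin(3)]
    linear_cmul[OF lin(1)] linear_neg[OF lin(1)]
  have "\<Psi> xs = 0" if "length xs = 3" "i < j" "j < 3" "xs ! i = xs ! j" for xs i j
    using alt that unfolding alternating_form_def by blast
  from this[of "[x, x, z]" 0 1 for x z] this[of "[x, z, z]" 1 2 for x z]
  have same: "\<Psi> [x, x, z] = 0" "\<Psi> [x, z, z] = 0" for x z
    by simp_all
  show ?thesis
  proof
    fix x x' y z c
    show "\<Psi> [x + x', y, z] = \<Psi> [x, y, z] + \<Psi> [x', y, z]"
      "\<Psi> [c *\<^sub>R x, y, z] = of_real c * \<Psi> [x, y, z]"
      by (simp_all add: lin_simps scaleR_conv_of_real)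
    show "\<Psi> [y, x, z] = - \<Psi> [x, y, z]"
      using same(1)[of "x + y" z] same(1)[of x z] same(1)[of y z]
      by (simp add: lin_simps eq_neg_iff_add_eq_0 add.commute)
    show "\<Psi> [x, z, y] = - \<Psi> [x, y, z]"
      using same(2)[of x "y + z"] same(2)[of x y] same(2)[of x z]
      by (simp add: lin_simps eq_neg_iff_add_eq_0 add.commute)
    have "\<Psi> [J x, y, z] = type_part J 3 0 \<Psi> [J x, y, z]"
      by (rule type[symmetric]) simp
    also have "\<dots> = \<i> * type_part J 3 0 \<Psi> [x, y, z]"
      unfolding type_part_3_0 by (simp add: J lin_simps algebra_simps)
    also have "\<dots> = \<i> * \<Psi> [x, y, z]"
      by (subst type) simp_all
    finally show "\<Psi> [J x, y, z] = \<i> * \<Psi> [x, y, z]" .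
  qed
qed

text \<open>
  The assumption \<open>expand\<close> fixes the complex dimension to three.
\<close>

locale unitary_frame = hermitian_space \<omega> J
  for \<omega> :: "'v::real_vector \<Rightarrow> 'v \<Rightarrow> real" and J +
  fixes v e f :: 'v
  assumes norm_1 [simp]: "g v v = 1" "g e e = 1" "g f f = 1"
    and orth: "g v e = 0" "g v (J e) = 0" "g v f = 0" "g v (J f) = 0" "g e f = 0" "g e (J f) = 0"
    and expand: "x = g v x *\<^sub>R v + g (J v) x *\<^sub>R J v + g e x *\<^sub>R e + g (J e) x *\<^sub>R J e
      + g f x *\<^sub>R f + g (J f) x *\<^sub>R J f"
begin

lemma orth_simps [simp]:
  "g v e = 0" "g v (J e) = 0" "g v f = 0" "g v (J f) = 0" "g e f = 0" "g e (J f) = 0"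
  "g (J v) e = 0" "g (J v) f = 0" "g (J e) f = 0"
  "g e v = 0" "g (J e) v = 0" "g f v = 0" "g (J f) v = 0" "g f e = 0" "g (J f) e = 0"
  "g e (J v) = 0" "g f (J v) = 0" "g f (J e) = 0"
  using orth metric_sym metric_J_left by (metis add.inverse_neutral)+

text \<open>
  The adjoint with respect to \<open>g\<close>, given by its expansion in the orthonormal frame.
\<close>

definition adj :: "('v \<Rightarrow> 'v) \<Rightarrow> 'v \<Rightarrow> 'v" where
  "adj A x = g (A v) x *\<^sub>R v + g (A (J v)) x *\<^sub>R J v + g (A e) x *\<^sub>R e + g (A (J e)) x *\<^sub>R J e
      + g (A f) x *\<^sub>R f + g (A (J f)) x *\<^sub>R J f"

lemma metric_adj:
  assumes "linear A"
  shows "g (adj A x) y = g x (A y)"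
proof -
  note A = linear_add[OF assms] linear_cmul[OF assms]
  have "g x (A y) = g x (A (g v y *\<^sub>R v + g (J v) y *\<^sub>R J v + g e y *\<^sub>R e + g (J e) y *\<^sub>R J e
      + g f y *\<^sub>R f + g (J f) y *\<^sub>R J f))"
    using expand[of y] by simp
  also have "\<dots> = g (adj A x) y"
    unfolding adj_def by (simp add: A metric_sym[of x] mult.commute)
  finally show ?thesis by simp
qed

lemma linear_adj: "linear (adj A)"
  by (rule linearI) (simp_all add: adj_def algebra_simps)

end

context hermitian_space
begin

lemma orthogonal_imp_independent:
  assumes "sorted_wrt (\<lambda>x y. g x y = 0) xs" "0 \<notin> set xs"
  shows "independent (set xs) \<and> distinct xs"
  using assms
proof (induction xs)
  case (Cons x xs)
  have "g x y = 0" if "y \<in> span (set xs)" for y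
    using that by (induction rule: span_induct_alt) (use Cons.prems in auto)
  from this[of x] have "x \<notin> span (set xs)" using Cons.prems(2) by auto
  then show ?case using Cons by (auto simp: independent_insert span_base)
qed (simp add: independent_empty)

text \<open>
  The induction step of Gram-Schmidt: the part of the new vector \<open>b\<close> that is orthogonal to \<open>B\<close> is used
  to correct the projection to \<open>B\<close>.
\<close>

lemma orthogonal_projection:
  assumes "finite B"
  shows "\<exists>p\<in>span B. \<forall>y\<in>span B. g (x - p) y = 0"
  using assms
proof (induction B arbitrary: x rule: finite_induct)
  case empty
  then show ?case by simp
next
  case (insert b B)
  obtain p where p: "p \<in> span B" "\<And>y. y \<in> span B \<Longrightarrow> g (x - p) y = 0"
    using insert.IH by blast
  obtain q where q: "q \<in> span B" "\<And>y. y \<in> span B \<Longrightarrow> g (b - q) y = 0"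
    using insert.IH by blast
  define c where "c = g (x - p) (b - q) / g (b - q) (b - q)"
  define p' where "p' = p + c *\<^sub>R (b - q)"
  have sub: "y \<in> span (insert b B)" if "y \<in> span B" for y
    using that span_mono[of B "insert b B"] by blast
  have "p' \<in> span (insert b B)"
    unfolding p'_def using sub[OF p(1)] sub[OF q(1)]
    by (intro span_add span_scale span_diff span_base[of b]) auto
  moreover have "g (x - p') y = 0" if "y \<in> span (insert b B)" for y
  proof -
    have c: "c * g (b - q) (b - q) = g (x - p) (b - q)"
    proof (cases "b - q = 0")
      case True
      then show ?thesis by (simp only: metric_bilinear(8) mult_zero_right)
    next
      case False
      then have "g (b - q) (b - q) \<noteq> 0" by (simp only: metric_self_eq_0 not_False_eq_True)
      then show ?thesis by (simp add: c_def del: metric_bilinear metric_self_eq_0)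
    qed
    obtain k where k: "y - k *\<^sub>R b \<in> span B"
      using \<open>y \<in> span (insert b B)\<close> by (auto simp: span_breakdown_eq)
    \<comment> \<open>both \<open>x - p'\<close> and \<open>y\<close> are split along \<open>B\<close> and the orthogonal direction \<open>b - q\<close>\<close>
    define y0 where "y0 = y - k *\<^sub>R b + k *\<^sub>R q"
    have y0: "y0 \<in> span B"
      unfolding y0_def by (intro span_add span_scale k q(1))
    have y: "y = y0 + k *\<^sub>R (b - q)"
      by (simp add: y0_def algebra_simps)
    have x: "x - p' = (x - p) - c *\<^sub>R (b - q)"
      by (simp add: p'_def)
    have "g (x - p') y = g (x - p) y0 + k * g (x - p) (b - q) - c * g (b - q) y0 - c * (k * g (b - q) (b - q))"
      unfolding y x metric_bilinear(2,3,9,10) by (simp only: algebra_simps metric_bilinear(9,10))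
    then show ?thesis
      using p(2)[OF y0] q(2)[OF y0] c by (simp del: metric_bilinear)
  qed
  ultimately show ?case by blast
qed

lemma unit_multiple:
  assumes "x \<noteq> 0"
  obtains c where "g (c *\<^sub>R x) (c *\<^sub>R x) = 1"
proof
  show "g ((1 / sqrt (g x x)) *\<^sub>R x) ((1 / sqrt (g x x)) *\<^sub>R x) = 1"
    using metric_pos[OF assms] assms by simp
qed

text \<open>
  If some \<open>y\<close> orthogonal to \<open>v\<close> were outside \<open>h\<close>, a basis of \<open>h\<close> together with \<open>y\<close> and \<open>v\<close> would be an
  independent set with more elements than the dimension allows.
\<close>

lemma unit_normal:
  assumes h: "subspace h" "dim h + 1 = dim (UNIV :: 'v set)"
    and finite: "\<And>B :: 'v set. independent B \<Longrightarrow> finite B"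
  obtains v where "g v v = 1" "\<And>x. x \<in> h \<longleftrightarrow> g v x = 0"
proof -
  obtain B where B: "B \<subseteq> h" "independent B" "h \<subseteq> span B" "card B = dim h"
    by (rule basis_exists)
  have span_B: "span B = h"
    using B(1,3) h(1) by (simp add: span_minimal subset_antisym)
  have finB: "finite B" by (rule finite[OF B(2)])
  obtain C :: "'v set" where "C \<subseteq> UNIV" and C: "independent C" "UNIV \<subseteq> span C"
    "card C = dim (UNIV :: 'v set)"
    by (rule basis_exists)
  have bound: "card S \<le> dim h + 1" if "independent S" for S :: "'v set"
  proof -
    have "S \<subseteq> span C" using C(2) by (rule subset_trans[OF subset_UNIV])
    then show ?thesis
      using independent_span_bound[OF finite[OF C(1)] that] C(3) h(2) by simp
  qed
  obtain x where x: "x \<notin> h"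
  proof -
    have "\<not> C \<subseteq> span B"
      using independent_span_bound[OF finB C(1)] C(3) B(4) h(2) by linarith
    then show ?thesis using that span_B by blast
  qed
  obtain p where p: "p \<in> h" "\<And>y. y \<in> h \<Longrightarrow> g (x - p) y = 0"
    using orthogonal_projection[OF finB, of x] span_B by blast
  have ne: "x - p \<noteq> 0" using x p(1) by auto
  then obtain c where c: "g (c *\<^sub>R (x - p)) (c *\<^sub>R (x - p)) = 1"
    by (rule unit_multiple)
  define v where "v = c *\<^sub>R (x - p)"
  have v_v: "g v v = 1" unfolding v_def by (rule c)
  have v_h: "g v y = 0" if "y \<in> h" for y
    unfolding v_def metric_bilinear(9) using p(2)[OF that] by simp
  have "y \<in> h" if y: "g v y = 0" for y
  proof (rule ccontr)
    assume "y \<notin> h"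
    then have y_B: "independent (insert y B)" "y \<notin> B"
      using B(2) span_B span_base by (auto simp: independent_insert)
    have "g v z = 0" if "z \<in> span (insert y B)" for z
      using that
    proof (induction rule: span_induct_alt)
      case (step c b z)
      then show ?case using y v_h B(1) by auto
    qed simp
    then have "v \<notin> span (insert y B)" using v_v by auto
    moreover from this have "v \<notin> insert y B" using span_base by blast
    ultimately have "independent (insert v (insert y B))" "v \<notin> insert y B"
      using y_B(1) by (simp_all add: independent_insert[of v])
    then show False
      using bound[of "insert v (insert y B)"] y_B(2) finB B(4) by simp
  qed
  with v_v v_h show ?thesis by (intro that) auto
qed

text \<open>
  Gram-Schmidt over the complex numbers.  It can be continued up to \<open>f\<close> because fewer than three complex
  lines cannot carry the form \<open>\<psi>\<close>, and it ends there because a vector outside the span of the three lines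
  would complete six orthonormal vectors to seven independent ones.
\<close>

lemma unitary_frame_exists:
  assumes \<psi>: "volume_form J \<psi>" "\<psi> x0 y0 z0 \<noteq> 0"
    and card: "\<And>B :: 'v set. independent B \<Longrightarrow> card B \<le> 6"
    and v: "g v v = 1"
  obtains e f where "unitary_frame \<omega> J v e f" "\<psi> v e f \<noteq> 0"
proof -
  interpret volume_form J \<psi> by (rule \<psi>(1))
  define P where "P p x = g p x *\<^sub>R p + g (J p) x *\<^sub>R J p" for p x
  have P: "g p (P p x) = g p x" "g (J p) (P p x) = g (J p) x" if "g p p = 1" for p x
    using that by (simp_all add: P_def)
  have P_orth: "g q (P p x) = 0" if "g q p = 0" "g (J q) p = 0" for p q x
    using that metric_J_left[of q p] by (simp add: P_def)
  have "\<exists>x. x - P v x \<noteq> 0"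
  proof (rule ccontr)
    assume none: "\<nexists>x. x - P v x \<noteq> 0"
    have "\<psi> x0 y0 z0 = 0"
    proof (rule vanishing)
      fix x
      have "x = g v x *\<^sub>R v + g (J v) x *\<^sub>R J v + 0 *\<^sub>R 0 + 0 *\<^sub>R J 0 + 0 *\<^sub>R 0 + 0 *\<^sub>R J 0"
        using none by (simp add: P_def)
      then show "\<exists>a a' b b' c c'. x = a *\<^sub>R v + a' *\<^sub>R J v + b *\<^sub>R 0 + b' *\<^sub>R J 0 + c *\<^sub>R 0 + c' *\<^sub>R J 0"
        by blast
    qed simp
    with \<psi>(2) show False ..
  qed
  then obtain x c where e': "g (c *\<^sub>R (x - P v x)) (c *\<^sub>R (x - P v x)) = 1"
    using unit_multiple by metis
  define e where "e = c *\<^sub>R (x - P v x)"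
  have e: "g e e = 1" unfolding e_def by (rule e')
  have ve: "g v e = 0" "g (J v) e = 0"
    using P[OF v] by (simp_all add: e_def)
  then have ev: "g e v = 0" "g (J e) v = 0"
    using metric_sym[of e v] metric_J_left[of e v] metric_sym[of e "J v"] by simp_all
  have "\<exists>y. y - P v y - P e y \<noteq> 0"
  proof (rule ccontr)
    assume none: "\<nexists>y. y - P v y - P e y \<noteq> 0"
    have "\<psi> x0 y0 z0 = 0"
    proof (rule vanishing)
      fix x
      have "x = g v x *\<^sub>R v + g (J v) x *\<^sub>R J v + g e x *\<^sub>R e + g (J e) x *\<^sub>R J e + 0 *\<^sub>R 0 + 0 *\<^sub>R J 0"
        using none by (simp add: P_def algebra_simps)
      then show "\<exists>a a' b b' c c'. x = a *\<^sub>R v + a' *\<^sub>R J v + b *\<^sub>R e + b' *\<^sub>R J e + c *\<^sub>R 0 + c' *\<^sub>R J 0"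
        by blast
    next
      show "\<psi> v e 0 = 0" using scale_3[of v e 0 0] by simp
    qed
    with \<psi>(2) show False ..
  qed
  then obtain y d where f': "g (d *\<^sub>R (y - P v y - P e y)) (d *\<^sub>R (y - P v y - P e y)) = 1"
    using unit_multiple by metis
  define f where "f = d *\<^sub>R (y - P v y - P e y)"
  have f: "g f f = 1" unfolding f_def by (rule f')
  have "g (J v) (P e y) = 0" "g (J e) (P v y) = 0"
    using ve ev metric_J_left[of v] metric_J_left[of e] by (simp_all add: P_def)
  then have vf: "g v f = 0" "g (J v) f = 0" and ef: "g e f = 0" "g (J e) f = 0"
    using P[OF v] P[OF e] P_orth[OF ve] P_orth[OF ev] by (simp_all add: f_def)
  have orth: "g v (J e) = 0" "g v (J f) = 0" "g e (J f) = 0"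
    using ve vf ef metric_J_left[of v e] metric_J_left[of v f] metric_J_left[of e f] by simp_all
  have expand: "z = g v z *\<^sub>R v + g (J v) z *\<^sub>R J v + g e z *\<^sub>R e + g (J e) z *\<^sub>R J e
      + g f z *\<^sub>R f + g (J f) z *\<^sub>R J f" for z
  proof (rule ccontr)
    define r where "r = z - P v z - P e z - P f z"
    assume "\<not> ?thesis"
    then have "r \<noteq> 0" by (simp add: r_def P_def algebra_simps)
    have "g p r = 0" if "p \<in> {v, J v, e, J e, f, J f}" for p
      using that ve vf ef ev orth v e f metric_J_left
        metric_sym[of f e] metric_sym[of f v] metric_sym[of f "J e"] metric_sym[of f "J v"]
        metric_sym[of e "J v"]
      by (auto simp: r_def P_def)
    then have r: "g r v = 0" "g r (J v) = 0" "g r e = 0" "g r (J e) = 0" "g r f = 0" "g r (J f) = 0"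
      using metric_sym[of r] by simp_all
    have nz: "v \<noteq> 0" "e \<noteq> 0" "f \<noteq> 0"
      using v e f by auto
    let ?L = "[r, v, J v, e, J e, f, J f]"
    have "sorted_wrt (\<lambda>x y. g x y = 0) ?L" "0 \<notin> set ?L"
      using r ve vf ef orth \<open>r \<noteq> 0\<close> nz by simp_all
    from orthogonal_imp_independent[OF this]
    have L: "independent (set ?L)" "distinct ?L" by blast+
    have "length ?L \<le> 6"
      using card[OF L(1)] distinct_card[OF L(2)] by (simp only:)
    then show False by simp
  qed
  have "unitary_frame \<omega> J v e f"
    by unfold_locales (fact v e f ve orth vf ef expand)+
  moreover have "\<psi> v e f \<noteq> 0"
  proof
    assume "\<psi> v e f = 0"
    then have "\<psi> x0 y0 z0 = 0"
    proof (rule vanishing[rotated])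
      show "\<exists>a a' b b' c c'. x = a *\<^sub>R v + a' *\<^sub>R J v + b *\<^sub>R e + b' *\<^sub>R J e + c *\<^sub>R f + c' *\<^sub>R J f" for x
        by (intro exI) (rule expand)
    qed
    with \<psi>(2) show False ..
  qed
  ultimately show ?thesis by (rule that)
qed

end

section \<open>Gauduchon connections in normal form\<close>

text \<open>
  The shape that the Lie algebra takes once all hypotheses of the theorem have been used: \<open>A\<close> is the
  adjoint action of the unit normal \<open>v\<close> of the abelian ideal.
\<close>

locale almost_abelian_normal_form = unitary_frame \<omega> J v e f
  for \<omega> :: "'g::lie_group6 lie_algebra \<Rightarrow> 'g lie_algebra \<Rightarrow> real" and J v e f +
  fixes A :: "'g lie_algebra \<Rightarrow> 'g lie_algebra"
  assumes bracket: "lie_bracket x y = g v x *\<^sub>R A y - g v y *\<^sub>R A x"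
    and linear_A: "linear A"
    and A_v: "A v = 0"
    and A_J: "A (J x) = J (A x)"
    and v_A: "g v (A x) = 0"
begin

text \<open>
  The symmetric part and the skew part of \<open>A\<close>.
\<close>

definition S :: "'g lie_algebra \<Rightarrow> 'g lie_algebra" where "S x = (1 / 2) *\<^sub>R (A x + adj A x)"
definition K :: "'g lie_algebra \<Rightarrow> 'g lie_algebra" where "K x = (1 / 2) *\<^sub>R (A x - adj A x)"

lemma A_eq: "A x = S x + K x"
  by (simp add: S_def K_def algebra_simps flip: scaleR_add_left)

lemma linear_S: "linear S" and linear_K: "linear K"
  using linear_compose_add[OF linear_A linear_adj] linear_compose_sub[OF linear_A linear_adj]
  by (auto simp: S_def[abs_def] K_def[abs_def] intro!: linear_compose_scale_right)

lemmas S_linear [simp] = linear_add[OF linear_S] linear_diff[OF linear_S] linear_neg[OF linear_S]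
  linear_0[OF linear_S] linear_cmul[OF linear_S]
lemmas K_linear [simp] = linear_add[OF linear_K] linear_diff[OF linear_K] linear_neg[OF linear_K]
  linear_0[OF linear_K] linear_cmul[OF linear_K]

lemma S_sym: "g (S x) y = g x (S y)" and K_skew: "g (K x) y = - g x (K y)"
  using metric_adj[OF linear_A, of x y] metric_adj[OF linear_A, of y x]
  by (simp_all add: S_def K_def metric_sym[of x "adj A y"] metric_sym[of y "A x"] field_simps)

lemma adj_J: "adj A (J x) = J (adj A x)"
  by (rule metric_eqI) (simp add: metric_adj linear_A metric_J_left A_J)

lemma S_J [simp]: "S (J x) = J (S x)" and K_J [simp]: "K (J x) = J (K x)"
  by (simp_all add: S_def K_def A_J adj_J)

lemma S_v [simp]: "S v = 0" and K_v [simp]: "K v = 0"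
proof -
  have "adj A v = 0"
    by (rule metric_eqI) (simp add: metric_adj linear_A v_A)
  then show "S v = 0" "K v = 0" by (simp_all add: S_def K_def A_v)
qed

lemma v_S [simp]: "g v (S x) = 0" "g (J v) (S x) = 0" "g v (J (S x)) = 0"
  and v_K [simp]: "g v (K x) = 0" "g (J v) (K x) = 0" "g v (J (K x)) = 0"
  using S_sym[of v x] S_sym[of "J v" x] K_skew[of v x] K_skew[of "J v" x] metric_J_left[of v]
  by auto

lemma S_v' [simp]: "g (S x) v = 0" "g (S x) (J v) = 0" "g (J (S x)) v = 0"
  and K_v' [simp]: "g (K x) v = 0" "g (K x) (J v) = 0" "g (J (K x)) v = 0"
  by (simp_all add: metric_sym[of _ v] metric_sym[of _ "J v"])

lemma v_J [simp]: "g v (J x) = - g (J v) x"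
  by (simp add: metric_J_left)

lemma bracket_v [simp]: "g v (lie_bracket x y) = 0" "g (J v) (lie_bracket x y) = 0"
  by (simp_all add: bracket A_eq)

lemma JS_skew: "g (J (S x)) y = - g x (J (S y))" "g (J (K x)) y = g x (J (K y))"
  using S_sym[of x "J y"] K_skew[of x "J y"] by (simp_all add: metric_J_left)

lemma K_self [simp]: "g (K x) x = 0" and JS_self [simp]: "g (J (S x)) x = 0"
  using K_skew[of x x] JS_skew(1)[of x x] metric_sym[of x] by simp_all

text \<open>
  A Chern connection satisfies \<open>C x y + J (C (J x) y) = [x, y] + J [J x, y]\<close>.  For \<open>x = v\<close> the right-hand side is
  \<open>A y\<close>, so that \<open>C v\<close> and \<open>J \<circ> C (J v)\<close> are the skew and the symmetric part of \<open>A\<close>; for \<open>x\<close> orthogonal to \<open>v\<close> and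
  \<open>J v\<close> it is zero.
\<close>

definition chern :: "'g lie_algebra \<Rightarrow> 'g lie_algebra \<Rightarrow> 'g lie_algebra" where
  "chern x y = g v x *\<^sub>R K y - g (J v) x *\<^sub>R J (S y)"

text \<open>
  The Levi-Civita connection plus half of the 3-form \<open>2 u \<and> \<sigma>\<close>, where \<open>u = g (J v)\<close> and \<open>\<sigma> x y = g (J (S x)) y\<close>,
  with its last argument raised to a vector.
\<close>

definition bismut :: "'g lie_algebra \<Rightarrow> 'g lie_algebra \<Rightarrow> 'g lie_algebra" where
  "bismut x y = g v x *\<^sub>R K y + g (J v) x *\<^sub>R J (S y) - g v y *\<^sub>R S x - g (J v) y *\<^sub>R J (S x)
     + g (S x) y *\<^sub>R v + g (J (S x)) y *\<^sub>R J v"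

lemma hermitian_chern: "hermitian_connection \<omega> J chern"
  unfolding hermitian_connection_def bilinear_def
proof (intro conjI allI)
  show "linear (chern x)" "linear (\<lambda>x. chern x y)" for x y
    by (rule linearI; simp add: chern_def algebra_simps)+
  show "chern x (J y) = J (chern x y)" for x y
    by (simp add: chern_def)
  show "g (chern x y) z + g y (chern x z) = 0" for x y z
    by (simp add: chern_def K_skew[of y z] JS_skew(1)[of y z])
qed

lemma hermitian_bismut: "hermitian_connection \<omega> J bismut"
  unfolding hermitian_connection_def bilinear_def
proof (intro conjI allI)
  show "linear (bismut x)" "linear (\<lambda>x. bismut x y)" for x y
    by (rule linearI; simp add: bismut_def algebra_simps)+
  show "bismut x (J y) = J (bismut x y)" for x y
    by (simp add: bismut_def metric_J_left[of "S x"])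
  show "g (bismut x y) z + g y (bismut x z) = 0" for x y z
    by (simp add: bismut_def K_skew[of y z] JS_skew(1)[of y z] metric_sym[of y "S x"]
        metric_sym[of y "J (S x)"] metric_sym[of y v] metric_sym[of y "J v"])
qed

lemma chern_eq:
  assumes "chern_connection \<omega> J C"
  shows "C = chern"
proof (rule chern_unique[OF _ hermitian_chern])
  show C: "hermitian_connection \<omega> J C"
    using assms by (simp add: chern_connection_def)
  have "torsion C (J x) (J y) = - torsion C x y" for x y
    using assms unfolding chern_connection_def type_part_1_1_eq_0_iff by blast
  moreover have "torsion chern (J x) (J y) = - torsion chern x y" for x y
    by (simp add: torsion_def chern_def bracket A_eq algebra_simps)
  moreover have "D x y - D y x + D (J x) (J y) - D (J y) (J x) =
      torsion D x y + torsion D (J x) (J y) + lie_bracket x y + lie_bracket (J x) (J y)" for D x y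
    by (simp add: torsion_def)
  ultimately show "C x y - C y x + C (J x) (J y) - C (J y) (J x) =
    chern x y - chern y x + chern (J x) (J y) - chern (J y) (J x)" for x y
    by simp
qed

lemma bismut_eq:
  assumes "bismut_connection \<omega> J B"
  shows "B = bismut"
proof (rule bismut_unique[OF _ hermitian_bismut])
  show B: "hermitian_connection \<omega> J B"
    using assms by (simp add: bismut_connection_def)
  fix x y
  have "alternating_form 3 (\<lambda>xs. g (torsion B (xs ! 0) (xs ! 1)) (xs ! 2))"
    using assms by (simp only: bismut_connection_def)
  then have "\<forall>xs i j. length xs = 3 \<longrightarrow> i < j \<longrightarrow> j < 3 \<longrightarrow> xs ! i = xs ! j \<longrightarrow>
      g (torsion B (xs ! 0) (xs ! 1)) (xs ! 2) = 0"
    unfolding alternating_form_def by (rule conjunct2)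
  from this[rule_format, of "[x, y, y]" 1 2] have "g (torsion B x y) y = 0"
    by simp
  then show "g (B x y - B y x) y = g (lie_bracket x y) y"
    by (simp add: torsion_def)
  show "g (bismut x y - bismut y x) y = g (lie_bracket x y) y"
    by (simp add: bismut_def bracket A_eq S_sym[of y x] JS_skew(1)[of y x] metric_sym[of y "S x"]
        metric_sym[of y "J (S x)"] algebra_simps)
qed

text \<open>
  The combination of the two preceding formulas: \<open>- \<tau>\<close> is \<open>(1 - \<tau>) / 2 - (1 + \<tau>) / 2\<close>.
\<close>

definition gauduchon :: "real \<Rightarrow> 'g lie_algebra \<Rightarrow> 'g lie_algebra \<Rightarrow> 'g lie_algebra" where
  "gauduchon \<tau> x y = g v x *\<^sub>R K y - (\<tau> * g (J v) x) *\<^sub>R J (S y)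
     + ((1 - \<tau>) / 2) *\<^sub>R (g (S x) y *\<^sub>R v + g (J (S x)) y *\<^sub>R J v
         - g v y *\<^sub>R S x - g (J v) y *\<^sub>R J (S x))"

lemma gauduchon_eq:
  assumes "gauduchon_connection \<omega> J \<tau> D"
  shows "D = gauduchon \<tau>"
proof -
  obtain C B where "chern_connection \<omega> J C" "bismut_connection \<omega> J B"
    and D: "D = (\<lambda>x y. ((1 + \<tau>) / 2) *\<^sub>R C x y + ((1 - \<tau>) / 2) *\<^sub>R B x y)"
    using assms unfolding gauduchon_connection_def by blast
  then have CB: "C = chern" "B = bismut"
    using chern_eq bismut_eq by blast+
  show ?thesis
  proof (intro ext)
    fix x y
    have 1: "((1 + \<tau>) / 2) *\<^sub>R z + ((1 - \<tau>) / 2) *\<^sub>R z = z" for z :: "'g lie_algebra"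
      by (simp add: scaleR_add_left[symmetric] field_simps)
    have "D x y = g v x *\<^sub>R (((1 + \<tau>) / 2) *\<^sub>R K y + ((1 - \<tau>) / 2) *\<^sub>R K y)
      + (((1 - \<tau>) / 2 - (1 + \<tau>) / 2) * g (J v) x) *\<^sub>R J (S y)
      + ((1 - \<tau>) / 2) *\<^sub>R (g (S x) y *\<^sub>R v + g (J (S x)) y *\<^sub>R J v
         - g v y *\<^sub>R S x - g (J v) y *\<^sub>R J (S x))"
      by (simp add: D CB chern_def bismut_def scaleR_add_left scaleR_add_right
          scaleR_diff_left scaleR_diff_right mult.commute left_diff_distrib right_diff_distrib)
    moreover have "(1 - \<tau>) / 2 - (1 + \<tau>) / 2 = - \<tau>" by (simp add: field_simps)
    ultimately show "D x y = gauduchon \<tau> x y"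
      by (simp add: 1 gauduchon_def)
  qed
qed

text \<open>
  On \<open>v\<close>, \<open>y\<close>, \<open>z\<close> the 3-form \<open>d\<omega>\<close> takes the value \<open>- 2 g (J (S y)) z\<close>, and it vanishes on the ideal.
\<close>

lemma kahler_iff: "kahler \<omega> \<longleftrightarrow> (\<forall>x. S x = 0)"
proof -
  have ext: "ext_deriv (two_form \<omega>) [x, y, z] =
      - g (J (lie_bracket x y)) z + g (J (lie_bracket x z)) y - g (J (lie_bracket y z)) x" for x y z
    unfolding ext_deriv_3 by (simp add: omega_eq_metric)
  have "S y = 0" if "kahler \<omega>" for y
  proof -
    have "g (J (S y)) z = 0" for z
    proof -
      have "ext_deriv (two_form \<omega>) [v, y, z] = 0"
        using that by (simp only: kahler_def list.size)
      then show ?thesis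
        unfolding ext using JS_skew(1)[of z y] JS_skew(2)[of z y]
        by (simp add: bracket A_v)
           (simp add: A_eq metric_sym[of z "J (S y)"] metric_sym[of z "J (K y)"])
    qed
    then have "J (S y) = 0" using metric_self_eq_0 by blast
    then show ?thesis by simp
  qed
  moreover have "kahler \<omega>" if S: "\<forall>x. S x = 0"
    unfolding kahler_def
  proof (intro allI impI)
    fix xs :: "'g lie_algebra list" assume "length xs = 3"
    then obtain x y z where xs: "xs = [x, y, z]"
      by (auto simp: numeral_3_eq_3 length_Suc_conv)
    have sym: "g (J (K x)) y = g (J (K y)) x" for x y
      using JS_skew(2)[of x y] metric_sym by simp
    show "ext_deriv (two_form \<omega>) xs = 0"
      unfolding xs ext
      by (simp add: bracket A_eq S sym[of z x] sym[of z y] sym[of y x])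
  qed
  ultimately show ?thesis by blast
qed

lemma gauduchon_minus_left: "gauduchon \<tau> (- x) y = - gauduchon \<tau> x y"
  by (simp add: gauduchon_def algebra_simps)

lemma curvature_gauduchon_skew:
  "curvature (gauduchon \<tau>) y x z = - curvature (gauduchon \<tau>) x y z"
proof -
  have "lie_bracket y x = - lie_bracket x y"
    by (simp add: bracket)
  then show ?thesis
    by (simp add: curvature_def gauduchon_minus_left)
qed

text \<open>
  The connection is then \<open>g v x *\<^sub>R K y\<close>: its endomorphisms commute with each other, and brackets have no
  component along \<open>v\<close>.
\<close>

lemma flat_if_S_eq_0:
  assumes "\<And>x. S x = 0"
  shows "flat (gauduchon \<tau>)"
  by (simp add: flat_def curvature_def gauduchon_def assms mult.commute)

lemma curvature_gauduchon_1:
  "curvature (gauduchon 1) x y z =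
    (g v y * g (J v) x - g v x * g (J v) y) *\<^sub>R J (K (S z) - S (K z))"
  by (simp add: curvature_def gauduchon_def algebra_simps)

lemma curvature_gauduchon_v:
  "curvature (gauduchon \<tau>) v (J v) v = 0"
  by (simp add: curvature_def gauduchon_def bracket A_eq)

text \<open>
  The connection in the directions \<open>x\<close> and \<open>J x\<close> moves \<open>v\<close> to multiples of \<open>S x\<close> and \<open>J (S x)\<close>, and these back
  into the plane of \<open>v\<close> and \<open>J v\<close>.  The commutator picks up the squared length of \<open>S x\<close>.
\<close>

lemma curvature_gauduchon_complement:
  assumes "g v x = 0" "g (J v) x = 0"
  shows "curvature (gauduchon \<tau>) x (J x) v = - ((1 - \<tau>)\<^sup>2 / 2 * g (S x) (S x)) *\<^sub>R J v"
proof -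
  define s where "s = (1 - \<tau>) / 2"
  have 1: "gauduchon \<tau> y v = (- s) *\<^sub>R S y" if "g v y = 0" "g (J v) y = 0" for y
    using that by (simp add: gauduchon_def s_def)
  have 2: "gauduchon \<tau> y (c *\<^sub>R S z) =
      (c * s) *\<^sub>R (g (S y) (S z) *\<^sub>R v + g (J (S y)) (S z) *\<^sub>R J v)"
    if "g v y = 0" "g (J v) y = 0" for y z c
    using that by (simp add: gauduchon_def s_def scaleR_add_right mult_ac)
  have "g v (J x) = 0" "g (J v) (J x) = 0" using assms by simp_all
  then have "curvature (gauduchon \<tau>) x (J x) v =
      gauduchon \<tau> x ((- s) *\<^sub>R S (J x)) - gauduchon \<tau> (J x) ((- s) *\<^sub>R S x)"
    using assms by (simp only: curvature_def bracket 1) (simp add: gauduchon_def)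
  also have "\<dots> = (- s * s) *\<^sub>R g (S x) (S x) *\<^sub>R J v - (s * s) *\<^sub>R g (S x) (S x) *\<^sub>R J v"
    using assms by (simp only: 2 \<open>g v (J x) = 0\<close> \<open>g (J v) (J x) = 0\<close>) simp
  also have "\<dots> = - (2 * (s * s) * g (S x) (S x)) *\<^sub>R J v"
    by (simp add: algebra_simps flip: scaleR_add_left)
  also have "2 * (s * s) = (1 - \<tau>)\<^sup>2 / 2"
    by (simp add: s_def power2_eq_square)
  finally show ?thesis .
qed

lemma instanton_trace:
  assumes "instanton \<omega> J (gauduchon \<tau>)"
  shows "curvature (gauduchon \<tau>) v (J v) z + curvature (gauduchon \<tau>) e (J e) z
    + curvature (gauduchon \<tau>) f (J f) z = 0"
proof (rule metric_eqI)
  fix w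
  let ?\<beta> = "curvature_coeff \<omega> J (gauduchon \<tau>) z w"
  have "wedge 4 2 (wedge 2 2 (two_form \<omega>) (two_form \<omega>)) ?\<beta> [v, J v, e, J e, f, J f] =
      2 * (?\<beta> [v, J v] + ?\<beta> [e, J e] + ?\<beta> [f, J f])"
  proof (rule wedge_unitary_frame)
    show "\<omega> y x = - \<omega> x y" for x y by (rule omega_skew)
    show "?\<beta> [y, x] = - ?\<beta> [x, y]" for x y
      using curvature_gauduchon_skew[of \<tau> y x z] by (simp add: curvature_coeff_def)
  qed (simp_all add: omega_eq_metric)
  moreover have "wedge 4 2 (wedge 2 2 (two_form \<omega>) (two_form \<omega>)) ?\<beta> [v, J v, e, J e, f, J f] = 0"
    using assms by (simp add: instanton_def)
  ultimately show "g (curvature (gauduchon \<tau>) v (J v) z + curvature (gauduchon \<tau>) e (J e) z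
    + curvature (gauduchon \<tau>) f (J f) z) w = g 0 w"
    by (simp add: curvature_coeff_def)
qed

text \<open>
  Applied to \<open>v\<close>, the plane of \<open>v\<close> and \<open>J v\<close> contributes nothing to the trace of the curvature, and the
  two other complex lines contribute with the same sign.
\<close>

lemma instanton_imp_S_eq_0:
  assumes inst: "instanton \<omega> J (gauduchon \<tau>)" and \<tau>: "\<tau> \<noteq> 1"
  shows "S x = 0"
proof -
  have "(1 - \<tau>)\<^sup>2 / 2 * (g (S e) (S e) + g (S f) (S f)) = 0"
    using arg_cong[OF instanton_trace[OF inst, of v], of "\<lambda>y. g y (J v)"]
    by (simp add: curvature_gauduchon_v curvature_gauduchon_complement algebra_simps)
  then have "g (S e) (S e) + g (S f) (S f) = 0"
    using \<tau> by simp
  then have "S e = 0" "S f = 0"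
    using metric_nonneg[of "S e"] metric_nonneg[of "S f"] by (simp_all add: add_nonneg_eq_0_iff)
  then show "S x = 0"
    by (subst expand[of x]) simp
qed

lemma instanton_imp_flat:
  assumes inst: "instanton \<omega> J (gauduchon \<tau>)"
  shows "flat (gauduchon \<tau>)"
proof (cases "\<tau> = 1")
  case False
  then show ?thesis
    by (intro flat_if_S_eq_0 instanton_imp_S_eq_0[OF inst])
next
  case True
  then have "J (K (S z) - S (K z)) = 0" for z
    using instanton_trace[OF inst, of z] by (simp add: curvature_gauduchon_1)
  then show ?thesis
    unfolding flat_def True curvature_gauduchon_1 by simp
qed

lemma flat_imp_instanton: "flat D \<Longrightarrow> instanton \<omega> J D"
  by (simp add: instanton_def wedge_def type_part_def curvature_coeff_def flat_def)

theorem instanton_gauduchon: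
  assumes "gauduchon_connection \<omega> J \<tau> D"
  shows "(instanton \<omega> J D \<longrightarrow> flat D) \<and> (\<tau> \<noteq> 1 \<longrightarrow> (instanton \<omega> J D \<longleftrightarrow> kahler \<omega>))"
  using instanton_imp_flat instanton_imp_S_eq_0 flat_imp_instanton flat_if_S_eq_0 kahler_iff
  unfolding gauduchon_eq[OF assms] by blast

end

section \<open>Reduction to the normal form\<close>

lemma hermitian_space_of_structure:
  assumes "hermitian_structure \<omega> J"
  shows "hermitian_space \<omega> J"
proof (rule hermitian_space.intro)
  have alt: "alternating_form 2 (two_form \<omega>)" and J: "complex_structure J"
    using assms by (simp_all only: hermitian_structure_def)
  have "linear (\<lambda>x. two_form \<omega> (xs[i := x]))" if "length xs = 2" "i < 2" for xs i
    using alt that unfolding alternating_form_def by blast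
  from this[of "[x, x]" 0 for x] this[of "[x, x]" 1 for x] show "bilinear \<omega>"
    by (simp add: bilinear_def)
  have "two_form \<omega> xs = 0" if "length xs = 2" "i < j" "j < 2" "xs ! i = xs ! j" for xs i j
    using alt that unfolding alternating_form_def by blast
  from this[of "[x, x]" 0 1 for x] show "\<omega> x x = 0" for x by simp
  show "\<omega> (J x) (J y) = \<omega> x y" for x y
    using assms unfolding hermitian_structure_def by blast
  show "linear J" using J by (simp only: complex_structure_def)
  show "J (J x) = - x" for x using J by (simp only: complex_structure_def)
  have "\<forall>x. x \<noteq> 0 \<longrightarrow> metric \<omega> J x x > 0"
    using assms unfolding hermitian_structure_def by blast
  then show "\<And>x. x \<noteq> 0 \<Longrightarrow> 0 < metric \<omega> J x x" by blast
qed

text \<open>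
  The hypotheses on the Lie algebra before the balanced condition and the holomorphy of
  the volume form are used; the
  abelian ideal is the orthogonal complement of \<open>v\<close>.
\<close>

locale almost_abelian_frame = unitary_frame \<omega> J v e f
  for \<omega> :: "'g::lie_group6 lie_algebra \<Rightarrow> 'g lie_algebra \<Rightarrow> real" and J v e f +
  assumes abelian: "g v x = 0 \<Longrightarrow> g v y = 0 \<Longrightarrow> lie_bracket x y = 0"
    and ideal: "g v y = 0 \<Longrightarrow> g v (lie_bracket x y) = 0"
    and integrable: "lie_bracket (J x) (J y) - J (lie_bracket (J x) y) - J (lie_bracket x (J y))
        - lie_bracket x y = 0"
begin

lemmas bracket_simps = bilinear_ladd[OF bilinear_lie_bracket] bilinear_radd[OF bilinear_lie_bracket]
  bilinear_lsub[OF bilinear_lie_bracket] bilinear_rsub[OF bilinear_lie_bracket]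
  bilinear_lmul[OF bilinear_lie_bracket] bilinear_rmul[OF bilinear_lie_bracket]
  bilinear_lneg[OF bilinear_lie_bracket] bilinear_rneg[OF bilinear_lie_bracket]
  lie_bracket_self

definition A :: "'g lie_algebra \<Rightarrow> 'g lie_algebra" where "A x = lie_bracket v x"

lemma linear_A: "linear A"
  using bilinear_lie_bracket unfolding A_def[abs_def] bilinear_def by blast

lemmas A_linear [simp] = linear_add[OF linear_A] linear_diff[OF linear_A] linear_neg[OF linear_A]
  linear_0[OF linear_A] linear_cmul[OF linear_A]

lemma A_v [simp]: "A v = 0"
  by (simp add: A_def lie_bracket_self)

lemma bracket_skew: "lie_bracket y x = - lie_bracket x y"
proof -
  have "lie_bracket (x + y) (x + y) = lie_bracket x y + lie_bracket y x"
    unfolding bracket_simps(1,2) by (simp add: lie_bracket_self)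
  then show ?thesis by (simp add: lie_bracket_self eq_neg_iff_add_eq_0 add.commute)
qed

lemma bracket: "lie_bracket x y = g v x *\<^sub>R A y - g v y *\<^sub>R A x"
proof -
  define x' y' where "x' = x - g v x *\<^sub>R v" and "y' = y - g v y *\<^sub>R v"
  have x: "x = g v x *\<^sub>R v + x'" and y: "y = g v y *\<^sub>R v + y'"
    by (simp_all add: x'_def y'_def)
  have "lie_bracket x' y' = 0"
    by (rule abelian) (simp_all add: x'_def y'_def)
  then have "lie_bracket x y = g v x *\<^sub>R A y' - g v y *\<^sub>R A x'"
    by (subst x, subst y) (simp add: bracket_simps A_def bracket_skew[of v x'])
  then show ?thesis by (simp add: x'_def y'_def)
qed

lemma v_A [simp]: "g v (A x) = 0"
proof -
  have "g v (lie_bracket v (x - g v x *\<^sub>R v)) = 0"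
    by (rule ideal) simp
  then show ?thesis by (simp add: A_def bracket_simps)
qed

lemma A_v' [simp]: "g (A x) v = 0"
  by (simp add: metric_sym[of _ v])

text \<open>
  Integrability for \<open>x\<close> and \<open>v\<close>: the brackets among \<open>x\<close>, \<open>J x\<close> and \<open>J v\<close> vanish, as these lie in the ideal.
\<close>

lemma A_J_complement:
  assumes "g v x = 0" "g (J v) x = 0"
  shows "A (J x) = J (A x)"
proof -
  have "J (A (J x)) + A x = 0"
    using integrable[of x v] assms metric_J_left[of v x] by (simp add: bracket)
  then have "J (J (A (J x)) + A x) = 0" by simp
  then show ?thesis by simp
qed

lemma Jv_A_complement:
  assumes "g v x = 0" "g (J v) x = 0"
  shows "g (A x) (J v) = 0"
  using v_A[of "J x"] metric_J_left[of v "A x"] metric_sym[of "A x" "J v"]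
  by (simp add: A_J_complement[OF assms])

text \<open>
  On \<open>v\<close> and four vectors of the ideal, \<open>d(\<omega>\<^sup>2)\<close> is up to sign the sum of the values of \<open>\<omega>\<^sup>2\<close> with \<open>A\<close> applied to
  one of the four.  On the complement of \<open>v\<close> and \<open>J v\<close>, where \<open>\<omega>\<^sup>2\<close> is a volume form, this sum is a multiple of
  the trace.
\<close>

lemma balanced_trace:
  assumes "balanced \<omega>"
  shows "g e (A e) + g f (A f) = 0"
proof -
  let ?w = "wedge 2 2 (two_form \<omega>) (two_form \<omega>)"
  have w: "?w [p, q, r, s] =
      2 * (g (J p) q * g (J r) s - g (J p) r * g (J q) s + g (J p) s * g (J q) r)" for p q r s
    using wedge_2_2[where \<omega> = \<omega>, OF omega_skew] by (simp add: omega_eq_metric)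
  have "ext_deriv ?w [v, e, J e, f, J f] = 0"
    using assms by (simp only: balanced_def list.size)
  then show ?thesis
    unfolding ext_deriv_5 w
    by (simp add: bracket A_J_complement metric_sym[of "A e" e] metric_sym[of "A f" f])
qed

text \<open>
  The form \<open>\<omega>\<close> restricted to the ideal has \<open>J v\<close> in its kernel.  If \<open>J v\<close> is among the four vectors of the ideal,
  only the term with \<open>A (J v)\<close> is left, and it tests the components of \<open>A (J v)\<close> in the complement.
\<close>

lemma balanced_A_Jv:
  assumes "balanced \<omega>"
  shows "A (J v) = g (J v) (A (J v)) *\<^sub>R J v"
proof -
  let ?w = "wedge 2 2 (two_form \<omega>) (two_form \<omega>)"
  have w: "?w [p, q, r, s] =
      2 * (g (J p) q * g (J r) s - g (J p) r * g (J q) s + g (J p) s * g (J q) r)" for p q r s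
    using wedge_2_2[where \<omega> = \<omega>, OF omega_skew] by (simp add: omega_eq_metric)
  have *: "g (J (A (J v))) p * g (J q) r - g (J (A (J v))) q * g (J p) r
      + g (J (A (J v))) r * g (J p) q = 0"
    if "g v p = 0" "g (J v) p = 0" "g v q = 0" "g (J v) q = 0" "g v r = 0" "g (J v) r = 0" for p q r
  proof -
    have "ext_deriv ?w [v, J v, p, q, r] = 0"
      using assms by (simp only: balanced_def list.size)
    then show ?thesis
      unfolding ext_deriv_5 w using that
      by (simp add: bracket Jv_A_complement)
  qed
  have "g (A (J v)) e = 0"
    using *[of "J e" f "J f"] by simp
  moreover have "g (A (J v)) (J e) = 0"
    using *[of e f "J f"] by (simp add: metric_J_left)
  moreover have "g (A (J v)) f = 0"
    using *[of "J f" e "J e"] by simp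
  moreover have "g (A (J v)) (J f) = 0"
    using *[of f e "J e"] by (simp add: metric_J_left)
  ultimately show ?thesis
    by (subst expand[of "A (J v)"])
       (simp add: metric_sym[of _ "A (J v)"])
qed

text \<open>
  The value of \<open>d\<Psi>\<close> on \<open>v\<close>, \<open>J v\<close>, \<open>e\<close>, \<open>f\<close> is \<open>\<Psi> [v, e, f]\<close> times \<open>- \<i>\<close> times a complex trace, namely \<open>a\<close> plus the
  complex trace of \<open>A\<close> on the complement.  The real part of the latter is the left-hand side.
\<close>

lemma holomorphic_trace:
  assumes "holomorphic_volume_form J \<Psi>" and ne: "\<Psi> [v, e, f] \<noteq> 0"
    and Jv: "A (J v) = a *\<^sub>R J v"
  shows "a + g e (A e) + g f (A f) = 0"
proof -
  have type: "type_part J 3 1 (ext_deriv \<Psi>) xs = 0" if "length xs = 4" for xs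
    using assms(1) that by (simp only: holomorphic_volume_form_def)
  interpret volume_form J "\<lambda>x y z. \<Psi> [x, y, z]"
    by (rule volume_form_of_type_3_0[OF J_J])
       (use assms(1) in \<open>simp_all only: holomorphic_volume_form_def\<close>)
  have d\<Psi>: "ext_deriv \<Psi> [v, J v, x, y] =
      - of_real a * \<Psi> [J v, x, y] + \<Psi> [A x, J v, y] - \<Psi> [A y, J v, x]"
    if "g v x = 0" "g v y = 0" for x y
    unfolding ext_deriv_4 using that by (simp add: bracket Jv scale zero)
  have "type_part J 3 1 (ext_deriv \<Psi>) [v, J v, e, f] = ext_deriv \<Psi> [v, J v, e, f]"
  proof (rule type_part_3_1[OF J_J])
    fix x y
    show "ext_deriv \<Psi> [v, - v, x, y] = 0" "ext_deriv \<Psi> [J v, J v, x, y] = 0"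
      unfolding ext_deriv_4 by (simp_all add: bracket_simps minus zero)
    show "ext_deriv \<Psi> [J v, - v, x, y] = ext_deriv \<Psi> [v, J v, x, y]"
      unfolding ext_deriv_4
      by (simp add: bracket_simps minus bracket_skew[where y = "J v" and x = v]
          skew_23[where z = "J v" and y = v])
  qed (simp_all add: d\<Psi> A_J_complement J_left J_2 J_3 algebra_simps)
  then have "- of_real a * \<Psi> [J v, e, f] + \<Psi> [A e, J v, f] - \<Psi> [A f, J v, e] = 0"
    using type[of "[v, J v, e, f]"] by (simp add: d\<Psi>)
  moreover have expand_\<Psi>: "\<Psi> [x, y, z] = Complex (g v x) (g (J v) x) * \<Psi> [v, y, z]
      + Complex (g e x) (g (J e) x) * \<Psi> [e, y, z] + Complex (g f x) (g (J f) x) * \<Psi> [f, y, z]"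
    for x y z
    using arg_cong[OF expand[of x], of "\<lambda>x. \<Psi> [x, y, z]"] by (simp only: expand_left)
  have "\<Psi> [A e, J v, f] = - (\<i> * Complex (g e (A e)) (g (J e) (A e)) * \<Psi> [v, e, f])"
    using expand_\<Psi>[of "A e" "J v" f] skew_12[where y = e and x = v and z = f]
    by (simp add: J_2)
  moreover have "\<Psi> [A f, J v, e] = \<i> * Complex (g f (A f)) (g (J f) (A f)) * \<Psi> [v, e, f]"
    using expand_\<Psi>[of "A f" "J v" e] skew_12[where y = f and x = v and z = e]
      skew_23[where x = v and z = f and y = e]
    by (simp add: J_2)
  ultimately have "\<i> * \<Psi> [v, e, f] *
      (of_real a + Complex (g e (A e)) (g (J e) (A e)) + Complex (g f (A f)) (g (J f) (A f))) = 0"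
    by (simp add: J_left algebra_simps neg_eq_iff_add_eq_0)
  then have "of_real a + Complex (g e (A e)) (g (J e) (A e)) + Complex (g f (A f)) (g (J f) (A f)) = 0"
    using ne by simp
  from arg_cong[OF this, of Re] show ?thesis by simp
qed

text \<open>
  The two trace conditions leave zero as the only possible eigenvalue of \<open>A\<close> on \<open>J v\<close>; hence \<open>A\<close>
  commutes with \<open>J\<close> on the plane of \<open>v\<close> and \<open>J v\<close> as well.
\<close>

lemma normal_form:
  assumes "balanced \<omega>" "holomorphic_volume_form J \<Psi>" "\<Psi> [v, e, f] \<noteq> 0"
  shows "almost_abelian_normal_form \<omega> J v e f A"
proof
  have "g (J v) (A (J v)) = 0"
    using holomorphic_trace[OF assms(2,3) balanced_A_Jv[OF assms(1)]] balanced_trace[OF assms(1)]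
    by simp
  then have Jv: "A (J v) = 0"
    using balanced_A_Jv[OF assms(1)] by simp
  show "A (J x) = J (A x)" for x
  proof -
    define y where "y = x - g v x *\<^sub>R v - g (J v) x *\<^sub>R J v"
    have x: "x = g v x *\<^sub>R v + g (J v) x *\<^sub>R J v + y"
      by (simp add: y_def)
    have "A (J y) = J (A y)"
      by (rule A_J_complement) (simp_all add: y_def)
    then show ?thesis
      by (subst x, subst (2) x) (simp add: Jv)
  qed
qed (simp_all add: bracket linear_A)

end

section \<open>Instantons on balanced almost abelian Lie groups\<close>

theorem proposition3p3:
  fixes \<omega> :: "'g::lie_group6 lie_algebra \<Rightarrow> 'g lie_algebra \<Rightarrow> real"
    and J :: "'g lie_algebra \<Rightarrow> 'g lie_algebra"
    and \<tau> :: real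
    and D :: "'g lie_algebra \<Rightarrow> 'g lie_algebra \<Rightarrow> 'g lie_algebra"
  assumes "almost_abelian TYPE('g)"
    and "hermitian_structure \<omega> J"
    and "balanced \<omega>"
    and "\<exists>\<Psi>. holomorphic_volume_form J \<Psi>"
    and "gauduchon_connection \<omega> J \<tau> D"
  shows "(instanton \<omega> J D \<longrightarrow> flat D) \<and>
         (\<tau> \<noteq> 1 \<longrightarrow> (instanton \<omega> J D \<longleftrightarrow> kahler \<omega>))"
proof -
  interpret hermitian_space \<omega> J
    by (rule hermitian_space_of_structure[OF assms(2)])
  have integrable: "lie_bracket (J x) (J y) - J (lie_bracket (J x) y) - J (lie_bracket x (J y))
      - lie_bracket x y = 0" for x y
    using assms(2) unfolding hermitian_structure_def complex_structure_def by blast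
  obtain h :: "'g lie_algebra set" where h: "subspace h" "dim h + 1 = dim (UNIV :: 'g lie_algebra set)"
    and ideal: "\<And>x y. y \<in> h \<Longrightarrow> lie_bracket x y \<in> h"
    and abelian: "\<And>x y. x \<in> h \<Longrightarrow> y \<in> h \<Longrightarrow> lie_bracket x y = 0"
    using assms(1) unfolding almost_abelian_def by blast
  obtain v where v: "g v v = 1" "\<And>x. x \<in> h \<longleftrightarrow> g v x = 0"
    using unit_normal[OF h] lie_algebra_independent_card by blast
  obtain \<Psi> where \<Psi>: "holomorphic_volume_form J \<Psi>" using assms(4) by blast
  then obtain xs where "length xs = 3" "\<Psi> xs \<noteq> 0"
    unfolding holomorphic_volume_form_def by blast
  then obtain x y z where nz: "\<Psi> [x, y, z] \<noteq> 0"
    by (auto simp: numeral_3_eq_3 length_Suc_conv)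
  have vol: "volume_form J (\<lambda>x y z. \<Psi> [x, y, z])"
    by (rule volume_form_of_type_3_0[OF J_J])
       (use \<Psi> in \<open>simp_all only: holomorphic_volume_form_def\<close>)
  obtain e f where frame: "unitary_frame \<omega> J v e f" and ef: "\<Psi> [v, e, f] \<noteq> 0"
    using unitary_frame_exists[OF vol nz _ v(1)] lie_algebra_independent_card by blast
  interpret unitary_frame \<omega> J v e f by (rule frame)
  interpret almost_abelian_frame \<omega> J v e f
  proof
    show "lie_bracket x y = 0" if "g v x = 0" "g v y = 0" for x y
      using that by (intro abelian) (simp_all only: v(2))
    show "g v (lie_bracket x y) = 0" if "g v y = 0" for x y
      using ideal[of y x] that by (simp only: v(2))
  qed (rule integrable)
  interpret almost_abelian_normal_form \<omega> J v e f A
    by (rule normal_form[OF assms(3) \<Psi> ef])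
  show ?thesis by (rule instanton_gauduchon[OF assms(5)])
qed

end
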